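(* If the degeneracy locus $X$ of a map $\varphi:\mathcal{O}_{\mathbb{P}^{5}}^{\oplus 2}\to\Omega_{\mathbb{P}^{5}}(2)$ has the expected dimension one, then $X$ is the union of three skew lines generating $\mathbb{P}^{5}$.
   Context: Work over an algebraically closed field $K$ of characteristic $0$. $\mathbb{P}^{5}=\mathbb{P}(V)$ with $\dim V=6$, and $\Omega_{\mathbb{P}^{5}}$ is the cotangent sheaf. One has $H^{0}(\Omega_{\mathbb{P}^{5}}(2))\simeq(\wedge^{2}V)^{\ast}$, so a map $\varphi:\mathcal{O}_{\mathbb{P}^{5}}^{\oplus 2}\to\Omega_{\mathbb{P}^{5}}(2)$ is given by two $6\times 6$ skew-symmetric matrices $A_{1},A_{2}$ with entries in $K$. Its degeneracy locus $X$ is the set of points $P\in\mathbb{P}^{5}$ such that $(\lambda_{1}A_{1}+\lambda_{2}A_{2})[P]=0$ for some $(\lambda_{1},\lambda_{2})\neq(0,0)$, where $[P]$ is the column of coordinates of $P$. "Generating $\mathbb{P}^{5}$" means that the linear span of the three lines is $\mathbb{P}^{5}$.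
   Formalization: The formal theorem also assumes that the degeneracy locus X, with its scheme structure given by the maximal minors of φ, is reduced; without this the claim fails, since X of dimension one can consist of only two lines, one of them double, spanning a P^3. *)

theory Defs
  imports "HOL-Analysis.Analysis" "HOL-Computational_Algebra.Polynomial"
begin

section \<open>Projective space and its Zariski topology\<close>

text \<open>A point of the projective space of a coordinate space is a one-dimensional subspace.\<close>

definition proj_points :: "('k::field ^ 'n) set \<Rightarrow> ('k ^ 'n) set set" where
  "proj_points W = {P. vec.subspace P \<and> vec.dim P = 1 \<and> P \<subseteq> W}"

abbreviation proj_space :: "('k::field ^ 'n) set set" where
  "proj_space \<equiv> proj_points UNIV"

definition proj_line :: "('k::field ^ 'n) set set \<Rightarrow> bool" where
  "proj_line l \<longleftrightarrow> (\<exists>W. vec.subspace W \<and> vec.dim W = 2 \<and> l = proj_points W)"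

definition linear_span :: "('k::field ^ 'n) set set \<Rightarrow> ('k ^ 'n) set set" where
  "linear_span X = proj_points (vec.span (\<Union>X))"

text \<open>
  Over an infinite field polynomials and polynomial functions are the same thing, so a form of
  degree \<open>d\<close> is represented by the function it defines. The zero form has every degree.
\<close>

definition form :: "nat \<Rightarrow> ('k::field ^ 'n \<Rightarrow> 'k) \<Rightarrow> bool" where
  "form d f \<longleftrightarrow> (\<exists>c :: ('n \<Rightarrow> nat) \<Rightarrow> 'k.
     f = (\<lambda>x. \<Sum>\<alpha> | (\<Sum>i\<in>UNIV. \<alpha> i) = d. c \<alpha> * (\<Prod>i\<in>UNIV. (x $ i) ^ \<alpha> i)))"

definition vanishes_on :: "('k::field ^ 'n \<Rightarrow> 'k) \<Rightarrow> ('k ^ 'n) set set \<Rightarrow> bool" where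
  "vanishes_on f X \<longleftrightarrow> (\<forall>P\<in>X. \<forall>x\<in>P. f x = 0)"

definition zariski_closed :: "('k::field ^ 'n) set set \<Rightarrow> bool" where
  "zariski_closed X \<longleftrightarrow> (\<exists>F. (\<forall>f\<in>F. \<exists>d. form d f) \<and>
     X = {P \<in> proj_space. \<forall>f\<in>F. vanishes_on f {P}})"

definition irreducible_closed :: "('k::field ^ 'n) set set \<Rightarrow> bool" where
  "irreducible_closed X \<longleftrightarrow> zariski_closed X \<and> X \<noteq> {} \<and>
     (\<forall>C D. zariski_closed C \<and> zariski_closed D \<and> X = C \<union> D \<longrightarrow> X = C \<or> X = D)"

text \<open>Krull dimension of a Zariski closed subset of projective space.\<close>

definition irreducible_chain :: "('k::field ^ 'n) set set \<Rightarrow> nat \<Rightarrow> bool" where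
  "irreducible_chain X m \<longleftrightarrow> (\<exists>Z :: nat \<Rightarrow> ('k ^ 'n) set set.
     (\<forall>i\<le>m. irreducible_closed (Z i) \<and> Z i \<subseteq> X) \<and> (\<forall>i<m. Z i \<subset> Z (Suc i)))"

definition has_dimension :: "('k::field ^ 'n) set set \<Rightarrow> nat \<Rightarrow> bool" where
  "has_dimension X d \<longleftrightarrow> irreducible_chain X d \<and> \<not> irreducible_chain X (Suc d)"

section \<open>Degeneracy loci of pencils of skew-symmetric matrices\<close>

definition skew_symmetric :: "'k::field ^ 'n ^ 'n \<Rightarrow> bool" where
  "skew_symmetric A \<longleftrightarrow> transpose A = - A"

text \<open>
  Skew-symmetric matrices \<open>A1\<close>, \<open>A2\<close> are the two global sections of \<open>\<Omega>(2)\<close> that make up a map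
  from \<open>O\<^sup>2\<close> to \<open>\<Omega>(2)\<close>: by the Euler sequence \<open>\<Omega>(2)\<close> is a subbundle of the sum of copies of
  \<open>O(1)\<close>, one for each coordinate, and the section belonging to \<open>A\<close> takes the value \<open>A *v x\<close>
  at the point spanned by \<open>x\<close>.
\<close>

definition degeneracy_locus :: "'k::field ^ 'n ^ 'n \<Rightarrow> 'k ^ 'n ^ 'n \<Rightarrow> ('k ^ 'n) set set" where
  "degeneracy_locus A1 A2 = {P \<in> proj_space. \<exists>l1 l2. (l1, l2) \<noteq> (0, 0) \<and>
     (\<forall>x\<in>P. (\<chi> i j. l1 * A1 $ i $ j + l2 * A2 $ i $ j) *v x = 0)}"

definition minor2 :: "'k::field ^ 'n ^ 'n \<Rightarrow> 'k ^ 'n ^ 'n \<Rightarrow> 'n \<Rightarrow> 'n \<Rightarrow> 'k ^ 'n \<Rightarrow> 'k" where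
  "minor2 A1 A2 i j x = (A1 *v x) $ i * (A2 *v x) $ j - (A1 *v x) $ j * (A2 *v x) $ i"

text \<open>
  The degeneracy scheme is cut out by the maximal minors of the map, that is by the forms
  \<open>minor2 A1 A2 i j\<close>. It is reduced iff the saturation of the ideal these forms generate is the
  whole ideal of the degeneracy locus: every form \<open>f\<close> vanishing on the locus lies in that ideal
  after multiplication by any form of some fixed degree \<open>N\<close>.

  Reducedness does not follow from the locus having dimension one, and without it the locus need
  not consist of three lines. If \<open>x\<^sub>1, \<dots>, x\<^sub>6\<close> are the coordinates and \<open>A1\<close>, \<open>A2\<close> send \<open>x\<close> to
  \<open>(x\<^sub>4, x\<^sub>5, x\<^sub>6, -x\<^sub>1, -x\<^sub>2, -x\<^sub>3)\<close> and \<open>(x\<^sub>5, 0, x\<^sub>6, 0, -x\<^sub>1, -x\<^sub>3)\<close>, then the locus is the union of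
  the two lines spanned by the coordinate points 2, 4 and 3, 6 (the first one being double in the
  degeneracy scheme).
\<close>

definition degeneracy_scheme_reduced :: "'k::field ^ 'n ^ 'n \<Rightarrow> 'k ^ 'n ^ 'n \<Rightarrow> bool" where
  "degeneracy_scheme_reduced A1 A2 \<longleftrightarrow>
     (\<forall>d f. form d f \<and> vanishes_on f (degeneracy_locus A1 A2) \<longrightarrow>
       (\<exists>N. \<forall>h. form N h \<longrightarrow>
         (\<exists>e g. (\<forall>i j. form e (g i j)) \<and>
           (\<forall>x. f x * h x = (\<Sum>i\<in>UNIV. \<Sum>j\<in>UNIV. g i j x * minor2 A1 A2 i j x)))))"

end

theory Submission
  imports Defs
begin

text \<open>
  If the Pfaffian vanishes on the whole pencil \<open>l1 A1 + l2 A2\<close>, then the locus has dimension at least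
  two: either some member has a kernel of dimension at least three, or the images of the Pfaffian
  adjugates, which are quadratic in \<open>(l1, l2)\<close>, sweep out an irreducible closed subset of the locus
  that properly contains a line.

  Otherwise the pencil is spanned by \<open>A\<close> and \<open>B\<close> with \<open>A\<close> invertible, and the locus is the disjoint
  union of the eigenspaces of \<open>A\<^sup>-\<^sup>1 B\<close>. A vector \<open>y\<close> with \<open>(A\<^sup>-\<^sup>1 B - \<mu>) y = x\<close>, where \<open>x \<noteq> 0\<close> is an
  eigenvector for \<open>\<mu>\<close>, would be a tangent vector of the degeneracy scheme at \<open>x\<close> that is not tangent
  to the locus, so by reducedness \<open>A\<^sup>-\<^sup>1 B\<close> is diagonalizable. Its eigenspaces are orthogonal for the
  alternating form \<open>A\<close>, so they have dimension at least two, and dimension at most two because the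
  locus is a curve. Hence there are exactly three of them.
\<close>

section \<open>The Pfaffian of a skew-symmetric matrix of size six\<close>

lemma exhaust_6:
  fixes x :: 6
  shows "x = 1 \<or> x = 2 \<or> x = 3 \<or> x = 4 \<or> x = 5 \<or> x = 6"
proof (induct x)
  case (of_int z)
  then have "z = 0 \<or> z = 1 \<or> z = 2 \<or> z = 3 \<or> z = 4 \<or> z = 5" by fastforce
  then show ?case by auto
qed

lemma forall_6: "(\<forall>i::6. P i) \<longleftrightarrow> P 1 \<and> P 2 \<and> P 3 \<and> P 4 \<and> P 5 \<and> P 6"
  by (metis exhaust_6)

lemma UNIV_6: "UNIV = {1, 2, 3, 4, 5, 6::6}"
  using exhaust_6 by auto

lemma sum_6: "sum f (UNIV::6 set) = f 1 + f 2 + f 3 + f 4 + f 5 + f 6"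
  unfolding UNIV_6 by (simp add: ac_simps)

lemma vector_6:
  "(vector [a,b,c,d,e,f] :: 'a::zero^6) $ 1 = a"
  "(vector [a,b,c,d,e,f] :: 'a^6) $ 2 = b"
  "(vector [a,b,c,d,e,f] :: 'a^6) $ 3 = c"
  "(vector [a,b,c,d,e,f] :: 'a^6) $ 4 = d"
  "(vector [a,b,c,d,e,f] :: 'a^6) $ 5 = e"
  "(vector [a,b,c,d,e,f] :: 'a^6) $ 6 = f"
  unfolding vector_def by simp_all

definition pf4 :: "'k::field ^ 'n ^ 'n \<Rightarrow> 'n \<Rightarrow> 'n \<Rightarrow> 'n \<Rightarrow> 'n \<Rightarrow> 'k" where
  "pf4 A i j k l = A $ i $ j * A $ k $ l - A $ i $ k * A $ j $ l + A $ i $ l * A $ j $ k"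

definition pfaffian :: "'k::field ^ 6 ^ 6 \<Rightarrow> 'k" where
  "pfaffian A = A $ 1 $ 2 * pf4 A 3 4 5 6 - A $ 1 $ 3 * pf4 A 2 4 5 6
     + A $ 1 $ 4 * pf4 A 2 3 5 6 - A $ 1 $ 5 * pf4 A 2 3 4 6 + A $ 1 $ 6 * pf4 A 2 3 4 5"

text \<open>
  The \<open>(i, j)\<close> entry is, up to sign, the Pfaffian of \<open>A\<close> with the rows and columns \<open>i\<close>, \<open>j\<close> deleted. The
  signs are chosen to give \<open>A ** pf_adj A = mat (pfaffian A)\<close>.
\<close>

definition pf_adj :: "'k::field ^ 6 ^ 6 \<Rightarrow> 'k ^ 6 ^ 6" where
  "pf_adj A = (let p = pf4 A in vector [
     vector [0, - p 3 4 5 6, p 2 4 5 6, - p 2 3 5 6, p 2 3 4 6, - p 2 3 4 5],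
     vector [p 3 4 5 6, 0, - p 1 4 5 6, p 1 3 5 6, - p 1 3 4 6, p 1 3 4 5],
     vector [- p 2 4 5 6, p 1 4 5 6, 0, - p 1 2 5 6, p 1 2 4 6, - p 1 2 4 5],
     vector [p 2 3 5 6, - p 1 3 5 6, p 1 2 5 6, 0, - p 1 2 3 6, p 1 2 3 5],
     vector [- p 2 3 4 6, p 1 3 4 6, - p 1 2 4 6, p 1 2 3 6, 0, - p 1 2 3 4],
     vector [p 2 3 4 5, - p 1 3 4 5, p 1 2 4 5, - p 1 2 3 5, p 1 2 3 4, 0]])"

lemma skew_nth:
  assumes "skew_symmetric A"
  shows "A $ i $ j = - A $ j $ i"
proof -
  have "transpose A $ j $ i = - A $ j $ i"
    using assms by (simp add: skew_symmetric_def)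
  then show ?thesis by (simp add: transpose_def)
qed

lemma skew_diag:
  fixes A :: "'k::field_char_0 ^ 'n ^ 'n"
  assumes "skew_symmetric A"
  shows "A $ i $ i = 0"
proof -
  have "A $ i $ i + A $ i $ i = 0" using skew_nth[OF assms, of i i] by simp
  then have "2 * A $ i $ i = 0" by (simp only: mult_2)
  then show ?thesis by simp
qed

lemma skew_pf_adj: "skew_symmetric (pf_adj A)"
  unfolding skew_symmetric_def transpose_def pf_adj_def Let_def
  by (simp add: vec_eq_iff forall_6 vector_6)

text \<open>Diagonal entries are expansions of the Pfaffian along a row; the other entries are
  expansions of Pfaffians with a repeated index.\<close>

lemma mult_pf_adj:
  fixes A :: "'k::field_char_0 ^ 6 ^ 6"
  assumes "skew_symmetric A"
  shows "A ** pf_adj A = mat (pfaffian A)"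
proof -
  note sk = skew_nth[OF assms] 
  have s: "A$2$1 = - A$1$2" "A$3$1 = - A$1$3" "A$4$1 = - A$1$4" "A$5$1 = - A$1$5" "A$6$1 = - A$1$6"
    "A$3$2 = - A$2$3" "A$4$2 = - A$2$4" "A$5$2 = - A$2$5" "A$6$2 = - A$2$6"
    "A$4$3 = - A$3$4" "A$5$3 = - A$3$5" "A$6$3 = - A$3$6"
    "A$5$4 = - A$4$5" "A$6$4 = - A$4$6" "A$6$5 = - A$5$6"
    by (rule sk)+
  show ?thesis
    unfolding vec_eq_iff forall_6 matrix_matrix_mult_def mat_def pf_adj_def Let_def
    by (simp add: sum_6 vector_6 s skew_diag[OF assms] pfaffian_def pf4_def algebra_simps)
qed

text \<open>Up to sign, \<open>pf4\<close> is alternating in its indices, so the fifteen increasing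
  quadruples suffice, and these are the entries of \<open>pf_adj A\<close> up to sign.\<close>

lemma pf4_eq_0:
  fixes A :: "'k::field_char_0 ^ 6 ^ 6"
  assumes "skew_symmetric A" "pf_adj A = 0"
  shows "pf4 A i j k l = 0"
proof -
  note sk = skew_nth[OF assms(1)] and d = skew_diag[OF assms(1)]
  have s: "pf4 A i j k l = 0 \<longleftrightarrow> pf4 A j i k l = 0" "pf4 A i j k l = 0 \<longleftrightarrow> pf4 A i k j l = 0"
     "pf4 A i j k l = 0 \<longleftrightarrow> pf4 A i j l k = 0" for i j k l
    using sk[of i j] sk[of j k] sk[of k l] by (auto simp: pf4_def algebra_simps)
  have e: "pf4 A i i k l = 0" "pf4 A i k k l = 0" "pf4 A i j k k = 0" for i j k l
    using sk[of i k] d[of i] d[of k] by (auto simp: pf4_def algebra_simps)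
  have z: "pf4 A 3 4 5 6 = 0" "pf4 A 2 4 5 6 = 0" "pf4 A 2 3 5 6 = 0" "pf4 A 2 3 4 6 = 0" "pf4 A 2 3 4 5 = 0"
    "pf4 A 1 4 5 6 = 0" "pf4 A 1 3 5 6 = 0" "pf4 A 1 3 4 6 = 0" "pf4 A 1 3 4 5 = 0"
    "pf4 A 1 2 5 6 = 0" "pf4 A 1 2 4 6 = 0" "pf4 A 1 2 4 5 = 0" "pf4 A 1 2 3 6 = 0" "pf4 A 1 2 3 5 = 0"
    "pf4 A 1 2 3 4 = 0"
    using assms(2) unfolding vec_eq_iff forall_6 pf_adj_def Let_def by (simp_all add: vector_6)
  \<comment> \<open>The rules \<open>s\<close> are permutative, so rewriting sorts the indices;
    \<open>z\<close> is brought to the same normal form first.\<close>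
  have "\<forall>i j k l. pf4 A i j k l = 0"
    unfolding forall_6 by (simp add: s e z[simplified s])
  then show ?thesis by blast
qed

section \<open>Polynomial functions and forms\<close>

definition polyfun :: "('k::field \<Rightarrow> 'k) \<Rightarrow> bool" where
  "polyfun g \<longleftrightarrow> (\<exists>p. \<forall>t. g t = poly p t)"

lemma polyfun_const: "polyfun (\<lambda>t. a)"
  unfolding polyfun_def by (rule exI[of _ "[:a:]"]) simp

lemma polyfun_id: "polyfun (\<lambda>t. t)"
  unfolding polyfun_def by (rule exI[of _ "[:0, 1:]"]) simp

lemma polyfun_add: "polyfun f \<Longrightarrow> polyfun g \<Longrightarrow> polyfun (\<lambda>t. f t + g t)"
  unfolding polyfun_def by (metis poly_add)

lemma polyfun_minus: "polyfun f \<Longrightarrow> polyfun (\<lambda>t. - f t)"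
  unfolding polyfun_def by (metis poly_minus)

lemma polyfun_diff: "polyfun f \<Longrightarrow> polyfun g \<Longrightarrow> polyfun (\<lambda>t. f t - g t)"
  unfolding polyfun_def by (metis poly_diff)

lemma polyfun_mult: "polyfun f \<Longrightarrow> polyfun g \<Longrightarrow> polyfun (\<lambda>t. f t * g t)"
  unfolding polyfun_def by (metis poly_mult)

lemma polyfun_power: "polyfun f \<Longrightarrow> polyfun (\<lambda>t. f t ^ n)"
  unfolding polyfun_def by (metis poly_power)

lemma polyfun_sum: "(\<And>i. i \<in> I \<Longrightarrow> polyfun (f i)) \<Longrightarrow> polyfun (\<lambda>t. \<Sum>i\<in>I. f i t)"
  by (induction I rule: infinite_finite_induct) (auto intro: polyfun_const polyfun_add)

lemma polyfun_prod: "(\<And>i. i \<in> I \<Longrightarrow> polyfun (f i)) \<Longrightarrow> polyfun (\<lambda>t. \<Prod>i\<in>I. f i t)"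
  by (induction I rule: infinite_finite_induct) (auto intro: polyfun_const polyfun_mult)

lemmas polyfun_intros = polyfun_const polyfun_id polyfun_add polyfun_minus polyfun_diff
  polyfun_mult polyfun_power polyfun_sum polyfun_prod

lemma polyfun_finite_zeros:
  assumes "polyfun g" "g a \<noteq> 0"
  shows "finite {t. g t = 0}"
proof -
  obtain p where p: "\<And>t. g t = poly p t" using assms(1) unfolding polyfun_def by blast
  then have "p \<noteq> 0" using assms(2) by auto
  then show ?thesis using poly_roots_finite[of p] by (simp add: p)
qed

text \<open>The factor \<open>t\<close> can be cancelled even at \<open>t = 0\<close>:
  \<open>g\<close> vanishes at the infinitely many nonzero points, hence everywhere.\<close>

lemma polyfun_eq_0_if_mult_id_eq_0:
  fixes g :: "'k::field_char_0 \<Rightarrow> 'k"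
  assumes "polyfun g" "\<And>t. t * g t = 0"
  shows "g a = 0"
proof (rule ccontr)
  assume "g a \<noteq> 0"
  then have "finite {t. g t = 0}" using polyfun_finite_zeros assms(1) by blast
  moreover have "- {0} \<subseteq> {t. g t = 0}" using assms(2) by auto
  ultimately have "finite (- {0::'k})" by (rule rev_finite_subset)
  then show False using infinite_UNIV_char_0 by (metis finite.emptyI finite.insertI finite_compl)
qed

definition polyfun_le :: "nat \<Rightarrow> ('k::field \<Rightarrow> 'k) \<Rightarrow> bool" where
  "polyfun_le n g \<longleftrightarrow> (\<exists>p. degree p \<le> n \<and> (\<forall>t. g t = poly p t))"

lemma polyfun_le_linear: "polyfun_le 1 (\<lambda>t. t * a + b)"
  unfolding polyfun_le_def by (rule exI[of _ "[:b, a:]"]) simp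

lemma polyfun_le_add: "polyfun_le n f \<Longrightarrow> polyfun_le n g \<Longrightarrow> polyfun_le n (\<lambda>t. f t + g t)"
  unfolding polyfun_le_def by (metis poly_add degree_add_le)

lemma polyfun_le_diff: "polyfun_le n f \<Longrightarrow> polyfun_le n g \<Longrightarrow> polyfun_le n (\<lambda>t. f t - g t)"
  unfolding polyfun_le_def by (metis poly_diff degree_diff_le)

lemma polyfun_le_mult: "polyfun_le m f \<Longrightarrow> polyfun_le n g \<Longrightarrow> polyfun_le (m + n) (\<lambda>t. f t * g t)"
  unfolding polyfun_le_def by (metis poly_mult degree_mult_le add_mono order_trans)

lemma card_zeros_polyfun_le:
  assumes "polyfun_le n g" "g a \<noteq> 0"
  shows "finite {t. g t = 0}" "card {t. g t = 0} \<le> n"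
proof -
  obtain p where p: "degree p \<le> n" "\<And>t. g t = poly p t"
    using assms(1) unfolding polyfun_le_def by blast
  then have "p \<noteq> 0" using assms(2) by auto
  then show "finite {t. g t = 0}" "card {t. g t = 0} \<le> n"
    using poly_roots_finite[of p] card_poly_roots_bound[of p] p by auto
qed

section \<open>Forms and their restrictions to polynomial curves\<close>

lemma finite_multi_indices: "finite {\<alpha> :: 'n::finite \<Rightarrow> nat. (\<Sum>i\<in>UNIV. \<alpha> i) = d}"
proof (rule finite_subset)
  show "{\<alpha> :: 'n \<Rightarrow> nat. (\<Sum>i\<in>UNIV. \<alpha> i) = d} \<subseteq> (UNIV \<rightarrow>\<^sub>E {..d})"
  proof clarify
    fix \<alpha> :: "'n \<Rightarrow> nat" assume "d = (\<Sum>i\<in>UNIV. \<alpha> i)"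
    then have "\<alpha> i \<le> d" for i using member_le_sum[of i UNIV \<alpha>] by simp
    then show "\<alpha> \<in> UNIV \<rightarrow>\<^sub>E {..(\<Sum>i\<in>UNIV. \<alpha> i)}"
      using \<open>d = _\<close> by auto
  qed
  show "finite ((UNIV :: 'n set) \<rightarrow>\<^sub>E {..d})" by (intro finite_PiE) auto
qed

text \<open>Several indices may carry the same exponent vector; grouping by exponents collects their
  coefficients. Products of forms need this freedom.\<close>

lemma formI:
  fixes a :: "'b \<Rightarrow> 'k::field" and \<beta> :: "'b \<Rightarrow> 'n::finite \<Rightarrow> nat"
  assumes "finite I" "\<And>b. b \<in> I \<Longrightarrow> (\<Sum>i\<in>UNIV. \<beta> b i) = d"
    and "\<And>x. f x = (\<Sum>b\<in>I. a b * (\<Prod>i\<in>UNIV. (x $ i) ^ \<beta> b i))"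
  shows "form d f"
  unfolding form_def
proof (intro exI ext)
  fix x :: "'k ^ 'n"
  let ?D = "{\<alpha> :: 'n \<Rightarrow> nat. (\<Sum>i\<in>UNIV. \<alpha> i) = d}"
  have "f x = (\<Sum>\<alpha>\<in>?D. \<Sum>b | b \<in> I \<and> \<beta> b = \<alpha>. a b * (\<Prod>i\<in>UNIV. (x $ i) ^ \<beta> b i))"
    unfolding assms(3) using assms(1,2) finite_multi_indices
    by (intro sum.group[symmetric]) auto
  also have "\<dots> = (\<Sum>\<alpha>\<in>?D. (\<Sum>b | b \<in> I \<and> \<beta> b = \<alpha>. a b) * (\<Prod>i\<in>UNIV. (x $ i) ^ \<alpha> i))"
    unfolding sum_distrib_right by (intro sum.cong) auto
  finally show "f x = \<dots>" .
qed

lemma form_mult: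
  fixes f g :: "'k::field ^ 'n \<Rightarrow> 'k"
  assumes "form d f" "form e g"
  shows "form (d + e) (\<lambda>x. f x * g x)"
proof -
  let ?D = "\<lambda>d. {\<alpha> :: 'n \<Rightarrow> nat. (\<Sum>i\<in>UNIV. \<alpha> i) = d}"
  obtain c where c: "f = (\<lambda>x. \<Sum>\<alpha>\<in>?D d. c \<alpha> * (\<Prod>i\<in>UNIV. (x $ i) ^ \<alpha> i))"
    using assms(1) unfolding form_def by blast
  obtain c' where c': "g = (\<lambda>x. \<Sum>\<alpha>\<in>?D e. c' \<alpha> * (\<Prod>i\<in>UNIV. (x $ i) ^ \<alpha> i))"
    using assms(2) unfolding form_def by blast
  show ?thesis
  proof (rule formI)
    show "finite (?D d \<times> ?D e)" by (intro finite_cartesian_product finite_multi_indices)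
    show "(\<Sum>i\<in>UNIV. (case b of (\<alpha>, \<beta>) \<Rightarrow> (\<lambda>i. \<alpha> i + \<beta> i)) i) = d + e" if "b \<in> ?D d \<times> ?D e" for b
      using that by (auto simp: sum.distrib)
    show "f x * g x = (\<Sum>b\<in>?D d \<times> ?D e. (case b of (\<alpha>, \<beta>) \<Rightarrow> c \<alpha> * c' \<beta>) *
       (\<Prod>i\<in>UNIV. (x $ i) ^ (case b of (\<alpha>, \<beta>) \<Rightarrow> (\<lambda>i. \<alpha> i + \<beta> i)) i))" for x
      unfolding c c' sum_product sum.cartesian_product
      by (intro sum.cong) (auto simp: power_add prod.distrib)
  qed
qed

lemma form_diff:
  assumes "form d f" "form d g"
  shows "form d (\<lambda>x. f x - g x)"
proof -
  let ?D = "{\<alpha>. (\<Sum>i\<in>UNIV. \<alpha> i) = d}"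
  obtain c where c: "f = (\<lambda>x. \<Sum>\<alpha>\<in>?D. c \<alpha> * (\<Prod>i\<in>UNIV. (x $ i) ^ \<alpha> i))"
    using assms(1) unfolding form_def by blast
  obtain c' where c': "g = (\<lambda>x. \<Sum>\<alpha>\<in>?D. c' \<alpha> * (\<Prod>i\<in>UNIV. (x $ i) ^ \<alpha> i))"
    using assms(2) unfolding form_def by blast
  show ?thesis unfolding form_def c c'
    by (rule exI[of _ "\<lambda>\<alpha>. c \<alpha> - c' \<alpha>"]) (simp add: left_diff_distrib sum_subtractf)
qed

lemma form_coord_power: "form n (\<lambda>x :: 'k::field ^ 'n. (x $ i) ^ n)"
proof (rule formI)
  show "finite {i}" by simp
  show "(\<Sum>j\<in>UNIV. if j = b then n else 0) = n" for b :: 'n by simp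
  show "(x $ i) ^ n = (\<Sum>b\<in>{i}. 1 * (\<Prod>j\<in>UNIV. (x $ j) ^ (if j = b then n else 0)))" for x :: "'k ^ 'n"
    by (simp add: if_distrib[of "(^) _"] cong: if_cong)
qed

lemma form_matrix_vector: "form 1 (\<lambda>x :: 'k::field ^ 'n. (M *v x) $ i)"
proof (rule formI)
  show "finite (UNIV :: 'n set)" by simp
  show "(\<Sum>j\<in>UNIV. if j = b then 1 else 0) = (1::nat)" for b :: 'n by simp
  show "(M *v x) $ i = (\<Sum>b\<in>UNIV. M $ i $ b * (\<Prod>j\<in>UNIV. (x $ j) ^ (if j = b then 1 else 0)))" for x
    by (simp add: matrix_vector_mult_def if_distrib[of "(^) _"] cong: if_cong)
qed

lemma form_minor2: "form 2 (minor2 A1 A2 i j)"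
proof -
  have "form (1 + 1) (\<lambda>x. (A1 *v x) $ i * (A2 *v x) $ j - (A1 *v x) $ j * (A2 *v x) $ i)"
    by (intro form_diff form_mult form_matrix_vector)
  then show ?thesis by (simp add: minor2_def[abs_def] numeral_2_eq_2)
qed

lemma form_homogeneous:
  assumes "form d f"
  shows "f (c *s x) = c ^ d * f x"
proof -
  let ?D = "{\<alpha>. (\<Sum>i\<in>UNIV. \<alpha> i) = d}"
  obtain a where a: "f = (\<lambda>x. \<Sum>\<alpha>\<in>?D. a \<alpha> * (\<Prod>i\<in>UNIV. (x $ i) ^ \<alpha> i))"
    using assms unfolding form_def by blast
  show ?thesis unfolding a sum_distrib_left
    by (intro sum.cong) (auto simp: power_mult_distrib prod.distrib power_sum[symmetric])
qed

lemma polyfun_form: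
  assumes "form d f" "\<And>i. polyfun (\<lambda>t. c t $ i)"
  shows "polyfun (\<lambda>t. f (c t))"
proof -
  let ?D = "{\<alpha>. (\<Sum>i\<in>UNIV. \<alpha> i) = d}"
  obtain a where a: "f = (\<lambda>x. \<Sum>\<alpha>\<in>?D. a \<alpha> * (\<Prod>i\<in>UNIV. (x $ i) ^ \<alpha> i))"
    using assms(1) unfolding form_def by blast
  show ?thesis unfolding a by (intro polyfun_intros assms(2))
qed

section \<open>Irreducible closed sets and chains\<close>

lemma proj_points_eq:
  assumes "vec.subspace W"
  shows "proj_points W = {vec.span {x} | x. x \<in> W \<and> x \<noteq> 0}"
proof (intro set_eqI iffI)
  fix P assume "P \<in> proj_points W"
  then have P: "vec.subspace P" "vec.dim P = 1" "P \<subseteq> W" by (auto simp: proj_points_def)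
  then have "\<not> P \<subseteq> {0}" by (metis vec.dim_eq_0 zero_neq_one)
  then obtain x where x: "x \<in> P" "x \<noteq> 0" by blast
  have "vec.span {x} = P"
    using x P by (intro vec.subspace_dim_equal vec.span_minimal) auto
  then show "P \<in> {vec.span {x} | x. x \<in> W \<and> x \<noteq> 0}" using x P(3) by blast
next
  fix P assume "P \<in> {vec.span {x} | x. x \<in> W \<and> x \<noteq> 0}"
  then obtain x where "P = vec.span {x}" "x \<in> W" "x \<noteq> 0" by blast
  then show "P \<in> proj_points W"
    using assms by (auto simp: proj_points_def vec.span_minimal subsetD[OF vec.span_minimal])
qed

lemma proj_space_eq: "proj_space = {vec.span {x} | x. x \<noteq> 0}"
  using proj_points_eq[OF vec.subspace_UNIV] by simp

lemma span_in_proj_points_iff: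
  assumes "vec.subspace W" "x \<noteq> 0"
  shows "vec.span {x} \<in> proj_points W \<longleftrightarrow> x \<in> W"
proof
  assume "vec.span {x} \<in> proj_points W"
  then show "x \<in> W" using vec.span_base[of x "{x}"] by (auto simp: proj_points_def)
next
  assume "x \<in> W"
  then show "vec.span {x} \<in> proj_points W" using assms by (auto simp: proj_points_eq)
qed

lemma vanishes_on_span_iff:
  assumes "form d f"
  shows "vanishes_on f {vec.span {x}} \<longleftrightarrow> f x = 0"
proof
  assume "vanishes_on f {vec.span {x}}"
  then show "f x = 0" using vec.span_base[of x "{x}"] by (auto simp: vanishes_on_def)
next
  assume "f x = 0"
  then show "vanishes_on f {vec.span {x}}"
    by (auto simp: vanishes_on_def vec.span_singleton form_homogeneous[OF assms])
qed

definition dotp :: "'k::field ^ 'n \<Rightarrow> 'k ^ 'n \<Rightarrow> 'k" where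
  "dotp x y = (\<Sum>i\<in>UNIV. x $ i * y $ i)"

lemma separating_vector:
  fixes x :: "'k::field ^ 'n"
  assumes "vec.subspace U" "x \<notin> U"
  obtains w where "\<And>u. u \<in> U \<Longrightarrow> dotp w u = 0" "dotp w x \<noteq> 0"
proof -
  obtain B where B: "B \<subseteq> U" "vec.independent B" "U \<subseteq> vec.span B"
    using vec.maximal_independent_subset by blast
  have "vec.span B = U" using B assms(1) by (meson vec.span_subspace)
  then have xB: "x \<notin> vec.span B" using assms(2) by simp
  then have ind: "vec.independent (insert x B)" using B(2) by (simp add: vec.independent_insertI)
  \<comment> \<open>\<open>g\<close> has values in the space itself, and \<open>1\<close> is the
    all-ones vector. Any coordinate of \<open>g\<close> is therefore a functional as required;
    \<open>undefined\<close> merely picks one.\<close>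
  obtain g :: "'k ^ 'n \<Rightarrow> 'k ^ 'n" where g: "Vector_Spaces.linear (*s) (*s) g"
    "\<And>b. b \<in> insert x B \<Longrightarrow> g b = (if b = x then 1 else 0)"
    using vec.linear_independent_extend[OF ind, of "\<lambda>b. if b = x then 1 else 0"] by blast
  have gU: "g u = 0" if "u \<in> U" for u
  proof (rule vec.linear_eq_on[OF g(1), of "\<lambda>_. 0", of u B])
    show "Vector_Spaces.linear (*s) (*s) (\<lambda>_. 0 :: 'k ^ 'n)" by (rule vec.linear_zero)
    show "u \<in> vec.span B" using that B by blast
    show "g b = 0" if "b \<in> B" for b using g(2)[of b] that xB vec.span_base[of b B] by auto
  qed
  have "g u $ j = (\<Sum>i\<in>UNIV. (\<chi> i. g (axis i 1) $ j) $ i * u $ i)" for u j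
    using linear_componentwise[OF g(1), of u j] by (simp add: mult.commute)
  from this[symmetric] show ?thesis
    using that[of "\<chi> i. g (axis i 1) $ undefined"] gU g(2)[of x] by (simp add: dotp_def)
qed

text \<open>The closure of the set of points spanned by the nonzero vectors of \<open>S\<close>.
  Working with vectors allows parametrizations that pass through 0.\<close>

definition zariski_closure :: "('k::field ^ 'n) set \<Rightarrow> ('k ^ 'n) set set" where
  "zariski_closure S = {P \<in> proj_space. \<forall>f. (\<exists>d. form d f) \<and> (\<forall>x\<in>S. f x = 0) \<longrightarrow> vanishes_on f {P}}"

lemma zariski_closure_closed: "zariski_closed (zariski_closure S)"
  unfolding zariski_closed_def zariski_closure_def
  by (rule exI[of _ "{f. (\<exists>d. form d f) \<and> (\<forall>x\<in>S. f x = 0)}"]) auto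

lemma span_in_zariski_closure:
  assumes "x \<in> S" "x \<noteq> 0"
  shows "vec.span {x} \<in> zariski_closure S"
  using assms by (auto simp: zariski_closure_def proj_space_eq vanishes_on_span_iff)

text \<open>
  Irreducibility is tested on curves: if forms \<open>f\<close>, \<open>g\<close> do not vanish at \<open>x\<close>, \<open>y\<close> respectively, then
  they both have finitely many zeros on a polynomial curve through \<open>x\<close> and \<open>y\<close>.
\<close>

lemma irreducible_zariski_closure:
  fixes S :: "('k::field_char_0 ^ 'n) set"
  assumes "x0 \<in> S" "x0 \<noteq> 0"
    and curve: "\<And>x y. x \<in> S \<Longrightarrow> y \<in> S \<Longrightarrow> x \<noteq> 0 \<Longrightarrow> y \<noteq> 0 \<Longrightarrow>
      \<exists>c. (\<forall>i. polyfun (\<lambda>t. c t $ i)) \<and> c 0 = x \<and> c 1 = y \<and> (\<forall>t. c t \<in> S)"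
    and zero: "\<And>x. x \<in> S \<Longrightarrow> \<exists>y\<in>S. y \<noteq> 0 \<and> x \<in> vec.span {y}"
  shows "irreducible_closed (zariski_closure S)"
  unfolding irreducible_closed_def
proof (intro conjI allI impI zariski_closure_closed)
  show "zariski_closure S \<noteq> {}" using span_in_zariski_closure assms by blast
  fix C D assume CD: "zariski_closed C \<and> zariski_closed D \<and> zariski_closure S = C \<union> D"
  \<comment> \<open>Some defining form of \<open>C\<close> is nonzero at a point of the closure
    outside \<open>C\<close>, so it cannot vanish on all of \<open>S\<close>. A form of degree 0
    might be nonzero only as witnessed by the zero vector; \<open>zero\<close> replaces that witness
    by a nonzero one.\<close>
  have separating: "\<exists>f d x. form d f \<and> x \<in> S \<and> x \<noteq> 0 \<and> f x \<noteq> 0 \<and> (\<forall>P\<in>C. vanishes_on f {P})"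
    if C: "zariski_closed C" "C \<subseteq> zariski_closure S" "C \<noteq> zariski_closure S" for C
  proof -
    obtain F where F: "\<And>f. f \<in> F \<Longrightarrow> \<exists>d. form d f" "C = {P \<in> proj_space. \<forall>f\<in>F. vanishes_on f {P}}"
      using C(1) unfolding zariski_closed_def by blast
    obtain P where P: "P \<in> zariski_closure S" "P \<notin> C" using C by blast
    then obtain f where f: "f \<in> F" "\<not> vanishes_on f {P}"
      using F(2) by (auto simp: zariski_closure_def)
    obtain d where d: "form d f" using F(1) f(1) by blast
    obtain x where x: "x \<in> S" "f x \<noteq> 0"
      using P(1) f(2) d by (auto simp: zariski_closure_def)
    obtain y where y: "y \<in> S" "y \<noteq> 0" "x \<in> vec.span {y}" using zero[OF x(1)] by blast
    have "f y \<noteq> 0" using x(2) y(3) by (auto simp: vec.span_singleton form_homogeneous[OF d])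
    then show ?thesis using d y F(2) f(1) by blast
  qed
  show "zariski_closure S = C \<or> zariski_closure S = D"
  proof (rule ccontr)
    assume "\<not> ?thesis"
    then obtain f d x g e y where f: "form d f" "x \<in> S" "x \<noteq> 0" "f x \<noteq> 0" "\<forall>P\<in>C. vanishes_on f {P}"
      and g: "form e g" "y \<in> S" "y \<noteq> 0" "g y \<noteq> 0" "\<forall>P\<in>D. vanishes_on g {P}"
      using separating[of C] separating[of D] CD by blast
    obtain c where c: "\<And>i. polyfun (\<lambda>t. c t $ i)" "c 0 = x" "c 1 = y" "\<And>t. c t \<in> S"
      using curve[of x y] f g by blast
    obtain i where i: "x $ i \<noteq> 0" using f(3) by (auto simp: vec_eq_iff)
    \<comment> \<open>The third set covers the parameters at which the curve passes through 0. Any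
      other parameter outside the first two sets gives a point of the closure in neither
      \<open>C\<close> nor \<open>D\<close>.\<close>
    have "finite ({t. f (c t) = 0} \<union> {t. g (c t) = 0} \<union> {t. c t $ i = 0})"
      using f g c i polyfun_finite_zeros[OF polyfun_form[OF f(1) c(1)], of 0]
       polyfun_finite_zeros[OF polyfun_form[OF g(1) c(1)], of 1]
       polyfun_finite_zeros[OF c(1), of 0 i] by simp
    from ex_new_if_finite[OF infinite_UNIV_char_0 this]
    obtain t where t: "f (c t) \<noteq> 0" "g (c t) \<noteq> 0" "c t $ i \<noteq> 0" by auto
    then have "c t \<noteq> 0" by auto
    then have "vec.span {c t} \<in> C \<union> D" using span_in_zariski_closure[OF c(4)] CD by blast
    then show False using f(1,5) g(1,5) t by (auto simp: vanishes_on_span_iff)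
  qed
qed

text \<open>A vector outside \<open>U\<close> is separated from \<open>U\<close> by a linear form,
  so no point is added by the closure.\<close>

lemma proj_points_eq_zariski_closure:
  assumes "vec.subspace U"
  shows "proj_points U = zariski_closure U"
proof (intro set_eqI iffI)
  fix P assume "P \<in> proj_points U"
  then show "P \<in> zariski_closure U"
    using assms span_in_zariski_closure by (auto simp: proj_points_eq)
next
  fix P assume P: "P \<in> zariski_closure U"
  then obtain x where x: "P = vec.span {x}" "x \<noteq> 0" by (auto simp: zariski_closure_def proj_space_eq)
  have "x \<in> U"
  proof (rule ccontr)
    assume "x \<notin> U"
    then obtain w where w: "\<And>u. u \<in> U \<Longrightarrow> dotp w u = 0" "dotp w x \<noteq> 0"
      using separating_vector assms by blast
    \<comment> \<open>The functional is any coordinate of the matrix all of whose rows are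
      \<open>w\<close>.\<close>
    have fo: "form 1 (\<lambda>x. dotp w x)"
      using form_matrix_vector[of "\<chi> i. w" undefined] by (simp add: matrix_vector_mult_def dotp_def)
    then have "vanishes_on (\<lambda>x. dotp w x) {P}"
      using P w(1) unfolding zariski_closure_def by blast
    then show False using w(2) by (simp add: x vanishes_on_span_iff[OF fo])
  qed
  then show "P \<in> proj_points U" using x assms by (simp add: span_in_proj_points_iff)
qed

lemma irreducible_proj_points:
  fixes U :: "('k::field_char_0 ^ 'n) set"
  assumes "vec.subspace U" "U \<noteq> {0}"
  shows "irreducible_closed (proj_points U)"
proof -
  obtain x0 where x0: "x0 \<in> U" "x0 \<noteq> 0" using assms vec.subspace_0 by blast
  show ?thesis unfolding proj_points_eq_zariski_closure[OF assms(1)]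
  proof (rule irreducible_zariski_closure[OF x0])
    fix x y assume "x \<in> U" "y \<in> U"
    then show "\<exists>c. (\<forall>i. polyfun (\<lambda>t. c t $ i)) \<and> c 0 = x \<and> c 1 = y \<and> (\<forall>t. c t \<in> U)"
      using assms(1)
      by (intro exI[of _ "\<lambda>t. x + t *s (y - x)"])
        (auto intro!: polyfun_intros vec.subspace_add vec.subspace_scale vec.subspace_diff)
  next
    fix x assume "x \<in> U"
    then show "\<exists>y\<in>U. y \<noteq> 0 \<and> x \<in> vec.span {y}"
      using x0 vec.span_base[of x "{x}"] vec.span_zero by (cases "x = 0") auto
  qed
qed

lemma proj_points_psubset:
  assumes "vec.subspace U" "vec.subspace W" "U \<subset> W"
  shows "proj_points U \<subset> proj_points W"
proof -
  obtain x where x: "x \<in> W" "x \<notin> U" using assms(3) by blast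
  then have "x \<noteq> 0" using assms(1) vec.subspace_0 by blast
  then have "vec.span {x} \<in> proj_points W - proj_points U"
    using x assms by (simp add: span_in_proj_points_iff)
  moreover have "proj_points U \<subseteq> proj_points W" using assms(3) by (auto simp: proj_points_def)
  ultimately show ?thesis by blast
qed

section \<open>Chains that show dimension at least two\<close>

lemma irreducible_chain_2I:
  assumes "irreducible_closed Z0" "irreducible_closed Z1" "irreducible_closed Z2"
    and "Z0 \<subset> Z1" "Z1 \<subset> Z2" "Z2 \<subseteq> X"
  shows "irreducible_chain X 2"
  unfolding irreducible_chain_def
proof (intro exI conjI allI impI)
  let ?Z = "\<lambda>i::nat. if i = 0 then Z0 else if i = 1 then Z1 else Z2"
  show "irreducible_closed (?Z i)" for i using assms by simp
  show "?Z i \<subseteq> X" for i using assms by auto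
  show "?Z i \<subset> ?Z (Suc i)" if "i < 2" for i using that assms by auto
qed

text \<open>The chain consists of a point of \<open>proj_points U\<close>, then
  \<open>proj_points U\<close> itself, then \<open>Z\<close>.\<close>

lemma irreducible_chain_2_above_line:
  fixes U :: "('k::field_char_0 ^ 'n) set"
  assumes "vec.subspace U" "vec.dim U \<ge> 2" "proj_points U \<subset> Z" "irreducible_closed Z" "Z \<subseteq> X"
  shows "irreducible_chain X 2"
proof -
  have "\<not> U \<subseteq> {0}" using assms(2) by (metis vec.dim_eq_0 not_numeral_le_zero)
  then obtain x where x: "x \<in> U" "x \<noteq> 0" by blast
  have sub: "vec.span {x} \<subseteq> U" using x assms(1) by (simp add: vec.span_minimal)
  have "vec.dim (vec.span {x}) = 1" using x by simp
  then have "vec.span {x} \<noteq> U" using assms(2) by auto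
  then have "vec.span {x} \<subset> U" using sub by blast
  then have *: "proj_points (vec.span {x}) \<subset> proj_points U"
    using assms(1) by (simp add: proj_points_psubset)
  have "U \<noteq> {0}" "vec.span {x} \<noteq> {0}" using x vec.span_base[of x "{x}"] by auto
  then show ?thesis
    using irreducible_chain_2I[OF _ _ assms(4) * assms(3,5)] assms(1) by (simp add: irreducible_proj_points)
qed

text \<open>Two vectors of a basis of \<open>W\<close> span a line properly contained in
  \<open>proj_points W\<close>.\<close>

lemma irreducible_chain_2_plane:
  fixes W :: "('k::field_char_0 ^ 'n) set"
  assumes "vec.subspace W" "vec.dim W \<ge> 3" "proj_points W \<subseteq> X"
  shows "irreducible_chain X 2"
proof -
  obtain B where B: "B \<subseteq> W" "vec.independent B" "card B = vec.dim W"
    using vec.basis_exists by metis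
  obtain C where C: "C \<subseteq> B" "card C = 2" using B(3) assms(2)
    by (metis obtain_subset_with_card_n le_trans numeral_le_iff semiring_norm(68) semiring_norm(72))
  let ?U = "vec.span C"
  have dim: "vec.dim ?U = 2" using C B(2) by (metis vec.dim_span_eq_card_independent vec.independent_mono)
  have "?U \<subseteq> W" using B(1) C(1) assms(1) by (metis subset_trans vec.span_minimal)
  moreover have "?U \<noteq> W" using dim assms(2) by auto
  ultimately have "proj_points ?U \<subset> proj_points W" using assms(1) by (simp add: proj_points_psubset psubsetI)
  moreover have "W \<noteq> {0}" using assms(2) by auto
  ultimately show ?thesis
    using irreducible_chain_2_above_line[of ?U "proj_points W" X] assms dim
    by (simp add: irreducible_proj_points)
qed

section \<open>Singular pencils\<close>

definition pencil :: "'k::field ^ 'n ^ 'n \<Rightarrow> 'k ^ 'n ^ 'n \<Rightarrow> 'k \<Rightarrow> 'k \<Rightarrow> 'k ^ 'n ^ 'n" where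
  "pencil A1 A2 l1 l2 = (\<chi> i j. l1 * A1 $ i $ j + l2 * A2 $ i $ j)"

lemma pencil_nth [simp]: "pencil A1 A2 l1 l2 $ i $ j = l1 * A1 $ i $ j + l2 * A2 $ i $ j"
  by (simp add: pencil_def)

lemma pencil_mult_vec: "pencil A1 A2 l1 l2 *v x = l1 *s (A1 *v x) + l2 *s (A2 *v x)"
  by (simp add: vec_eq_iff matrix_vector_mult_def sum.distrib sum_distrib_left algebra_simps)

lemma skew_pencil:
  assumes "skew_symmetric A1" "skew_symmetric A2"
  shows "skew_symmetric (pencil A1 A2 l1 l2)"
proof -
  have "transpose (pencil A1 A2 l1 l2) $ i $ j = (- pencil A1 A2 l1 l2) $ i $ j" for i j
    using skew_nth[OF assms(1), of j i] skew_nth[OF assms(2), of j i] by (simp add: transpose_def)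
  then show ?thesis by (simp add: skew_symmetric_def vec_eq_iff)
qed

lemma degeneracy_locus_eq:
  "degeneracy_locus A1 A2 =
    {vec.span {x} | x. x \<noteq> 0 \<and> (\<exists>l1 l2. (l1, l2) \<noteq> (0, 0) \<and> pencil A1 A2 l1 l2 *v x = 0)}"
proof -
  have "(\<forall>y\<in>vec.span {x}. M *v y = 0) \<longleftrightarrow> M *v x = 0" for M :: "'a ^ 'b ^ 'b" and x
  proof
    assume "\<forall>y\<in>vec.span {x}. M *v y = 0"
    then show "M *v x = 0" using vec.span_base[of x "{x}"] by simp
  qed (auto simp: vec.span_singleton vec.scale)
  then show ?thesis
    unfolding degeneracy_locus_def pencil_def[symmetric] proj_space_eq by blast
qed

lemma span_in_degeneracy_locus:
  assumes "x \<noteq> 0" "(l1, l2) \<noteq> (0, 0)" "pencil A1 A2 l1 l2 *v x = 0"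
  shows "vec.span {x} \<in> degeneracy_locus A1 A2"
  unfolding degeneracy_locus_eq using assms by blast

lemma minor2_eq_0:
  assumes "(l1, l2) \<noteq> (0, 0)" "pencil A1 A2 l1 l2 *v x = 0"
  shows "minor2 A1 A2 i j x = 0"
proof -
  have *: "l1 * (A1 *v x) $ k + l2 * (A2 *v x) $ k = 0" for k
    using assms(2) by (simp add: pencil_mult_vec vec_eq_iff)
  have "l1 * minor2 A1 A2 i j x =
      (l1 * (A1 *v x) $ i + l2 * (A2 *v x) $ i) * (A2 *v x) $ j
      - (l1 * (A1 *v x) $ j + l2 * (A2 *v x) $ j) * (A2 *v x) $ i"
    "l2 * minor2 A1 A2 i j x =
      (l1 * (A1 *v x) $ j + l2 * (A2 *v x) $ j) * (A1 *v x) $ i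
      - (l1 * (A1 *v x) $ i + l2 * (A2 *v x) $ i) * (A1 *v x) $ j"
    by (simp_all add: minor2_def algebra_simps)
  then show ?thesis using assms(1) by (auto simp: *)
qed

text \<open>If coordinate \<open>i\<close> of \<open>A1 *v x\<close> is nonzero, the minors with
  index \<open>i\<close> make \<open>A2 *v x\<close> a multiple of \<open>A1 *v x\<close>, and the
  relation is read off at coordinate \<open>i\<close>.\<close>

lemma degenerate_if_minors_eq_0:
  assumes "\<And>i j. minor2 A1 A2 i j x = 0"
  shows "\<exists>l1 l2. (l1, l2) \<noteq> (0, 0) \<and> pencil A1 A2 l1 l2 *v x = 0"
proof (cases "A1 *v x = 0")
  case True
  then show ?thesis by (intro exI[of _ 1] exI[of _ 0]) (simp add: pencil_mult_vec)
next
  case False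
  then obtain i where i: "(A1 *v x) $ i \<noteq> 0" by (auto simp: vec_eq_iff)
  then show ?thesis
    using assms[of i]
    by (intro exI[of _ "(A2 *v x) $ i"] exI[of _ "- (A1 *v x) $ i"])
      (simp add: pencil_mult_vec vec_eq_iff minor2_def algebra_simps)
qed

lemma matrix_mult_axis: "(A :: 'k::field ^ 'n ^ 'n) *v axis k 1 = column k A"
  by (simp add: vec_eq_iff matrix_vector_mult_def column_def axis_def mult_delta_right)

text \<open>The locus is cut out by the minors, which are forms: they vanish on \<open>S\<close>,
  hence on its closure.\<close>

lemma zariski_closure_subset_degeneracy_locus:
  assumes "\<And>x. x \<in> S \<Longrightarrow> \<exists>l1 l2. (l1, l2) \<noteq> (0, 0) \<and> pencil A1 A2 l1 l2 *v x = 0"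
  shows "zariski_closure S \<subseteq> degeneracy_locus A1 A2"
proof
  fix P assume P: "P \<in> zariski_closure S"
  then obtain x where x: "P = vec.span {x}" "x \<noteq> 0" by (auto simp: zariski_closure_def proj_space_eq)
  have "minor2 A1 A2 i j x = 0" for i j
  proof -
    have "\<forall>y\<in>S. minor2 A1 A2 i j y = 0" using assms minor2_eq_0 by blast
    then have "vanishes_on (minor2 A1 A2 i j) {P}"
      using P form_minor2 unfolding zariski_closure_def by blast
    then show ?thesis by (simp add: x(1) vanishes_on_span_iff[OF form_minor2])
  qed
  from degenerate_if_minors_eq_0[OF this] show "P \<in> degeneracy_locus A1 A2"
    using x span_in_degeneracy_locus by blast
qed

lemma irreducible_chain_2_kernel:
  fixes A1 A2 :: "'k::field_char_0 ^ 'n ^ 'n"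
  assumes "vec.subspace W" "vec.dim W \<ge> 3" "(l1, l2) \<noteq> (0, 0)"
    "\<And>x. x \<in> W \<Longrightarrow> pencil A1 A2 l1 l2 *v x = 0"
  shows "irreducible_chain (degeneracy_locus A1 A2) 2"
proof (rule irreducible_chain_2_plane[OF assms(1,2)])
  show "proj_points W \<subseteq> degeneracy_locus A1 A2"
    using assms span_in_degeneracy_locus by (fastforce simp: proj_points_eq)
qed

text \<open>Vanishing sub-Pfaffians of size four force rank at most two: if \<open>A $ i $ j\<close>
  is nonzero, rows \<open>i\<close> and \<open>j\<close> span all rows, so two linear equations cut
  out the kernel.\<close>

lemma pf_adj_eq_0_kernel:
  fixes A :: "'k::field_char_0 ^ 6 ^ 6"
  assumes "skew_symmetric A" "pf_adj A = 0"
  obtains W where "vec.subspace W" "vec.dim W \<ge> 3" "\<And>x. x \<in> W \<Longrightarrow> A *v x = 0"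
proof (cases "A = 0")
  case True
  then show ?thesis using that[of UNIV] by (simp add: card_cart_basis)
next
  case False
  then obtain i j where ij: "A $ i $ j \<noteq> 0" by (auto simp: vec_eq_iff)
  define W where "W = {x. (A *v x) $ i = 0 \<and> (A *v x) $ j = 0}"
  have sub: "vec.subspace W" by (auto simp: W_def vec.subspace_def vec.add vec.scale)
  have ker: "A *v x = 0" if "x \<in> W" for x
  proof -
    have "A $ i $ j * A $ k $ l = A $ i $ k * A $ j $ l - A $ i $ l * A $ j $ k" for k l
      using pf4_eq_0[OF assms, of i j k l] by (simp add: pf4_def algebra_simps)
    then have "A $ i $ j * (A *v x) $ k = A $ i $ k * (A *v x) $ j - A $ j $ k * (A *v x) $ i" for k
      by (simp add: matrix_vector_mult_def sum_distrib_left sum_subtractf[symmetric] mult.assoc[symmetric])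
        (simp add: algebra_simps)
    then show ?thesis using that ij by (simp add: W_def vec_eq_iff)
  qed
  have "x \<in> vec.span (insert (axis i 1) (insert (axis j 1) W))" (is "_ \<in> vec.span ?S") for x
  proof -
    let ?a = "(A *v x) $ i / A $ i $ j" and ?b = "(A *v x) $ j / A $ i $ j"
    \<comment> \<open>The diagonal of \<open>A\<close> is zero, so the correction along
      \<open>axis j 1\<close> changes only coordinate \<open>i\<close> of the two relevant
      coordinates of \<open>A *v x\<close>, and the one along \<open>axis i 1\<close> only
      coordinate \<open>j\<close>.\<close>
    have "x - ?a *s axis j 1 + ?b *s axis i 1 \<in> W"
      using ij skew_nth[OF assms(1), of j i]
      by (simp add: W_def vec.add vec.diff vec.scale matrix_mult_axis column_def skew_diag[OF assms(1)])
    then have "x - ?a *s axis j 1 + ?b *s axis i 1 \<in> vec.span ?S" by (intro vec.span_base) simp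
    moreover have "?a *s axis j 1 - ?b *s axis i 1 \<in> vec.span ?S"
      by (intro vec.span_diff vec.span_scale vec.span_base) auto
    ultimately have "(x - ?a *s axis j 1 + ?b *s axis i 1) + (?a *s axis j 1 - ?b *s axis i 1) \<in> vec.span ?S"
      by (rule vec.span_add)
    then show ?thesis by simp
  qed
  then have "vec.span ?S = UNIV" by blast
  then have "vec.dim ?S = 6" using vec.dim_span[of ?S] by (simp only: vec_dim_card) simp
  moreover have "vec.dim ?S \<le> vec.dim W + 2" by (simp add: vec.dim_insert)
  ultimately show ?thesis using that[OF sub _ ker] by simp
qed

lemma polyfun_pf_adj:
  assumes "\<And>i j. polyfun (\<lambda>t. M t $ i $ j)"
  shows "polyfun (\<lambda>t. pf_adj (M t) $ i $ j)"
proof -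
  have pf4: "polyfun (\<lambda>t. pf4 (M t) i j k l)" for i j k l
    unfolding pf4_def by (intro polyfun_intros assms)
  have "\<forall>i j. polyfun (\<lambda>t. pf_adj (M t) $ i $ j)"
    unfolding pf_adj_def Let_def forall_6 vector_6 by (intro conjI polyfun_const polyfun_minus pf4)
  then show ?thesis by blast
qed

text \<open>Sub-Pfaffians are quadratic in entries that are linear in \<open>l1\<close>,
  \<open>l2\<close>. With \<open>binary_quadratic_root\<close>, some member of the pencil has an
  adjugate with a prescribed entry equal to zero.\<close>

lemma pf_adj_pencil_quadratic:
  "\<exists>a b c. \<forall>l1 l2. pf_adj (pencil A1 A2 l1 l2) $ i $ j = a * l1 ^ 2 + b * l1 * l2 + c * l2 ^ 2"
proof -
  define Q where "Q f \<longleftrightarrow> (\<exists>a b c. \<forall>l1 l2. f l1 l2 = a * l1 ^ 2 + b * l1 * l2 + c * l2 ^ 2)" for f :: "'a \<Rightarrow> 'a \<Rightarrow> 'a"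
  have zero: "Q (\<lambda>l1 l2. 0)" unfolding Q_def by (intro exI[of _ 0]) simp
  have minus: "Q (\<lambda>l1 l2. - f l1 l2)" if Qf: "Q f" for f
  proof -
    obtain a b c where "\<And>l1 l2. f l1 l2 = a * l1 ^ 2 + b * l1 * l2 + c * l2 ^ 2"
      using Qf unfolding Q_def by blast
    then show ?thesis unfolding Q_def
      by (intro exI[of _ "-a"] exI[of _ "-b"] exI[of _ "-c"]) simp
  qed
  have pf4: "Q (\<lambda>l1 l2. pf4 (pencil A1 A2 l1 l2) i j k l)" for i j k l
    unfolding Q_def
    by (intro exI[of _ "pf4 A1 i j k l"] exI[of _ "pf4 A2 i j k l"]
       exI[of _ "A1$i$j * A2$k$l - A1$i$k * A2$j$l + A1$i$l * A2$j$k
         + A2$i$j * A1$k$l - A2$i$k * A1$j$l + A2$i$l * A1$j$k"])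
     (simp add: pf4_def power2_eq_square algebra_simps)
  have "\<forall>i j. Q (\<lambda>l1 l2. pf_adj (pencil A1 A2 l1 l2) $ i $ j)"
    unfolding pf_adj_def Let_def forall_6 vector_6 by (intro conjI zero minus pf4)
  then show ?thesis unfolding Q_def by blast
qed

lemma binary_quadratic_root:
  fixes a b c :: "'k::alg_closed_field"
  shows "\<exists>l1 l2. (l1, l2) \<noteq> (0, 0) \<and> a * l1 ^ 2 + b * l1 * l2 + c * l2 ^ 2 = 0"
proof (cases "c = 0")
  case True
  then show ?thesis by (intro exI[of _ 0] exI[of _ 1]) simp
next
  case False
  then obtain t where "poly [:a, b, c:] t = 0"
    using alg_closed_imp_poly_has_root[of "[:a, b, c:]"] by auto
  then show ?thesis
    by (intro exI[of _ 1] exI[of _ t]) (simp add: power2_eq_square algebra_simps)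
qed

lemma irreducible_chain_2_singular_pencil:
  fixes A1 A2 :: "'k::{alg_closed_field, field_char_0} ^ 6 ^ 6"
  assumes skew: "skew_symmetric A1" "skew_symmetric A2"
    and pf: "\<And>l1 l2. pfaffian (pencil A1 A2 l1 l2) = 0"
  shows "irreducible_chain (degeneracy_locus A1 A2) 2"
proof (cases "\<exists>l1 l2. (l1, l2) \<noteq> (0, 0) \<and> pf_adj (pencil A1 A2 l1 l2) = 0")
  case True
  then show ?thesis
    using pf_adj_eq_0_kernel[OF skew_pencil[OF skew]] irreducible_chain_2_kernel by metis
next
  case False
  define P where "P l1 l2 = pf_adj (pencil A1 A2 l1 l2)" for l1 l2
  have P_ne: "P l1 l2 \<noteq> 0" if "(l1, l2) \<noteq> (0, 0)" for l1 l2
    using False that by (auto simp: P_def)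
  have P0: "P 0 0 = 0"
  proof -
    have "pencil A1 A2 0 0 = 0" by (simp add: vec_eq_iff)
    then show ?thesis by (simp add: P_def pf_adj_def pf4_def vec_eq_iff forall_6 vector_6)
  qed
  have P_skew: "P l1 l2 $ i $ j = - P l1 l2 $ j $ i" and P_diag: "P l1 l2 $ i $ i = 0" for l1 l2 i j
    unfolding P_def by (rule skew_nth[OF skew_pf_adj], rule skew_diag[OF skew_pf_adj])
  have ker: "pencil A1 A2 l1 l2 *v (P l1 l2 *v w) = 0" for l1 l2 w
    unfolding P_def matrix_vector_mul_assoc mult_pf_adj[OF skew_pencil[OF skew]] pf
    by (simp add: mat_def vec_eq_iff matrix_vector_mult_def)
  define S where "S = {P l1 l2 *v w | l1 l2 w. True}"
  have "P 1 0 \<noteq> 0" using P_ne by simp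
  then obtain i j where ij: "P 1 0 $ i $ j \<noteq> 0" by (auto simp: vec_eq_iff)
  define u where "u = P 1 0 *v axis i 1"
  define v where "v = P 1 0 *v axis j 1"
  define U where "U = vec.span {u, v}"
  \<comment> \<open>By skewness, columns \<open>i\<close> and \<open>j\<close> of
    \<open>P 1 0\<close> have an invertible block in rows \<open>i\<close> and \<open>j\<close>.
    Hence they are independent, and a vector of their span is determined by its coordinates
    \<open>i\<close> and \<open>j\<close>.\<close>
  have uv: "u $ i = 0" "u $ j \<noteq> 0" "v $ i \<noteq> 0" "v $ j = 0"
    using ij P_skew[of 1 0 i j] by (simp_all add: u_def v_def matrix_mult_axis column_def P_diag)
  have comb: "x \<in> U \<longleftrightarrow> (\<exists>a b. x = a *s u + b *s v)" for x
    unfolding U_def vec.span_insert vec.span_singleton by (auto simp: algebra_simps)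
  have U_eq_0: "x = 0" if "x \<in> U" "x $ i = 0" "x $ j = 0" for x
    using that uv by (auto simp: comb)
  have "u \<notin> vec.span {v}" "v \<noteq> 0" using uv by (auto simp: vec.span_singleton)
  then have U: "vec.subspace U" "vec.dim U = 2" unfolding U_def by (simp_all add: vec.dim_insert)
  have "u \<in> S" "u \<noteq> 0" unfolding S_def u_def using uv(2) u_def by auto
  have irr: "irreducible_closed (zariski_closure S)"
  proof (rule irreducible_zariski_closure[OF \<open>u \<in> S\<close> \<open>u \<noteq> 0\<close>])
    fix x y assume "x \<in> S" "y \<in> S"
    then obtain l1 l2 w m1 m2 w' where x: "x = P l1 l2 *v w" and y: "y = P m1 m2 *v w'"
      unfolding S_def by blast
    \<comment> \<open>The curve moves all parameters along straight lines.\<close>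
    let ?c = "\<lambda>t. P (l1 + t * (m1 - l1)) (l2 + t * (m2 - l2)) *v (w + t *s (w' - w))"
    have "polyfun (\<lambda>t. ?c t $ k)" for k
      unfolding P_def matrix_vector_mult_def
      by simp (intro polyfun_intros polyfun_pf_adj, simp, intro polyfun_intros)
    moreover have "\<forall>t. ?c t \<in> S" unfolding S_def by blast
    ultimately show "\<exists>c. (\<forall>i. polyfun (\<lambda>t. c t $ i)) \<and> c 0 = x \<and> c 1 = y \<and> (\<forall>t. c t \<in> S)"
      by (intro exI[of _ ?c]) (simp add: x y)
  next
    fix x assume "x \<in> S"
    then show "\<exists>y\<in>S. y \<noteq> 0 \<and> x \<in> vec.span {y}"
      using \<open>u \<in> S\<close> \<open>u \<noteq> 0\<close> vec.span_base[of x "{x}"] vec.span_zero by (cases "x = 0") auto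
  qed
  have sub: "zariski_closure S \<subseteq> degeneracy_locus A1 A2"
  proof (rule zariski_closure_subset_degeneracy_locus)
    fix x assume "x \<in> S"
    then obtain l1 l2 w where x: "x = P l1 l2 *v w" unfolding S_def by blast
    show "\<exists>l1 l2. (l1, l2) \<noteq> (0, 0) \<and> pencil A1 A2 l1 l2 *v x = 0"
    proof (cases "(l1, l2) = (0, 0)")
      case True
      then show ?thesis using x P0 by (intro exI[of _ 1] exI[of _ 0]) simp
    next
      case False
      then show ?thesis using x ker by blast
    qed
  qed
  have "\<not> S \<subseteq> U"
  proof
    assume "S \<subseteq> U"
    \<comment> \<open>For this member, columns \<open>i\<close> and \<open>j\<close> vanish in rows
      \<open>i\<close> and \<open>j\<close>, so they vanish altogether if \<open>S\<close> lies in
      \<open>U\<close>. By skewness rows \<open>i\<close> and \<open>j\<close> vanish, and then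
      every column does, although the adjugate is nonzero.\<close>
    obtain l1 l2 where l: "(l1, l2) \<noteq> (0, 0)" "P l1 l2 $ i $ j = 0"
      using pf_adj_pencil_quadratic[of A1 A2 i j] binary_quadratic_root unfolding P_def by metis
    have col: "P l1 l2 $ k $ m = 0" if "P l1 l2 $ i $ m = 0" "P l1 l2 $ j $ m = 0" for k m
    proof -
      have "P l1 l2 *v axis m 1 \<in> U" using \<open>S \<subseteq> U\<close> unfolding S_def by blast
      then have "P l1 l2 *v axis m 1 = 0"
        using that by (intro U_eq_0) (auto simp: matrix_mult_axis column_def)
      then show ?thesis by (simp add: matrix_mult_axis column_def vec_eq_iff)
    qed
    have "P l1 l2 $ k $ i = 0" "P l1 l2 $ k $ j = 0" for k
      using col[of i k] col[of j k] l(2) P_diag P_skew[of l1 l2 j i] by simp_all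
    then have "P l1 l2 $ k $ m = 0" for k m
      using col[of m k] P_skew[of l1 l2 i m] P_skew[of l1 l2 j m] by simp
    then show False using P_ne[OF l(1)] by (simp add: vec_eq_iff)
  qed
  then obtain x where x: "x \<in> S" "x \<notin> U" by blast
  have "x \<noteq> 0" using x(2) U(1) vec.subspace_0 by blast
  then have "vec.span {x} \<in> zariski_closure S - proj_points U"
    using x U(1) by (simp add: span_in_proj_points_iff span_in_zariski_closure)
  moreover have "U \<subseteq> S"
  proof
    fix x assume "x \<in> U"
    then obtain a b where "x = a *s u + b *s v" using comb by blast
    then have "x = P 1 0 *v (a *s axis i 1 + b *s axis j 1)"
      by (simp add: u_def v_def vec.add vec.scale)
    then show "x \<in> S" unfolding S_def by blast
  qed
  then have "proj_points U \<subseteq> zariski_closure S"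
    using U(1) span_in_zariski_closure by (auto simp: proj_points_eq)
  ultimately have "proj_points U \<subset> zariski_closure S" by blast
  then show ?thesis using irreducible_chain_2_above_line[OF U(1) _ _ irr sub] U(2) by simp
qed

section \<open>Eigenspaces of a regular pencil\<close>

lemma polyfun_le_pfaffian_pencil: "polyfun_le 3 (\<lambda>t. pfaffian (pencil A B t 1))"
proof -
  have entry: "polyfun_le 1 (\<lambda>t. pencil A B t 1 $ i $ j)" for i j
    using polyfun_le_linear[of "A $ i $ j" "B $ i $ j"] by simp
  have "polyfun_le (1 + (1 + 1)) (\<lambda>t. pfaffian (pencil A B t 1))"
    unfolding pfaffian_def pf4_def
    by (intro polyfun_le_add polyfun_le_diff polyfun_le_mult entry)
  then show ?thesis by (simp add: numeral_3_eq_3)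
qed

lemma pfaffian_scale: "pfaffian (pencil A B (c * l1) (c * l2)) = c ^ 3 * pfaffian (pencil A B l1 l2)"
  by (simp add: pfaffian_def pf4_def power3_eq_cube algebra_simps)

text \<open>For invertible \<open>A\<close> this is an eigenspace of the inverse of \<open>A\<close>
  times \<open>B\<close>. Without the inverse, it is visibly the kernel of a skew-symmetric member
  of the pencil.\<close>

definition eigenspace :: "'k::field ^ 'n ^ 'n \<Rightarrow> 'k ^ 'n ^ 'n \<Rightarrow> 'k \<Rightarrow> ('k ^ 'n) set" where
  "eigenspace A B \<mu> = {x. B *v x = \<mu> *s (A *v x)}"

lemma subspace_eigenspace: "vec.subspace (eigenspace A B \<mu>)"
  by (auto simp: eigenspace_def vec.subspace_def vec.add vec.scale vec.scale_right_distrib mult.commute)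

lemma eigenspace_eq_kernel: "eigenspace A B \<mu> = {x. pencil A B (- \<mu>) 1 *v x = 0}"
  by (auto simp: eigenspace_def pencil_mult_vec)

definition eigenvalues :: "'k::field ^ 'n ^ 'n \<Rightarrow> 'k ^ 'n ^ 'n \<Rightarrow> 'k set" where
  "eigenvalues A B = {\<mu>. \<exists>x. x \<noteq> 0 \<and> x \<in> eigenspace A B \<mu>}"

lemma eigenspaces_disjoint:
  assumes "\<And>x. A *v x = 0 \<Longrightarrow> x = 0" "x \<in> eigenspace A B \<mu>" "x \<in> eigenspace A B \<nu>" "\<mu> \<noteq> \<nu>"
  shows "x = 0"
proof -
  have "(\<mu> - \<nu>) *s (A *v x) = 0" using assms(2,3) by (simp add: eigenspace_def vec.scale_left_diff_distrib)
  then show ?thesis using assms(1,4) by simp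
qed

text \<open>Transposing \<open>mult_pf_adj\<close> shows that the adjugate is also a left inverse of
  \<open>A\<close> up to the nonzero factor \<open>pfaffian A\<close>.\<close>

lemma pfaffian_nz_inj:
  fixes A :: "'k::field_char_0 ^ 6 ^ 6"
  assumes "skew_symmetric A" "pfaffian A \<noteq> 0" "A *v x = 0"
  shows "x = 0"
proof -
  have "transpose (A ** pf_adj A) = mat (pfaffian A)"
    unfolding mult_pf_adj[OF assms(1)] by (simp add: transpose_mat)
  then have "pf_adj A ** A = mat (pfaffian A)"
    using assms(1) skew_pf_adj[of A] unfolding matrix_transpose_mul skew_symmetric_def
    by (simp add: matrix_matrix_mult_def)
  then have "mat (pfaffian A) *v x = 0"
    using assms(3) by (metis matrix_vector_mul_assoc matrix_vector_mult_0_right)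
  moreover have "mat (pfaffian A) *v x = pfaffian A *s x"
    by (simp add: vec_eq_iff mat_def matrix_vector_mult_def if_distrib[of "\<lambda>a. a * _"] cong: if_cong)
  ultimately show ?thesis using assms(2) by simp
qed

text \<open>Negated eigenvalues are zeros of the Pfaffian along the pencil, a polynomial of degree
  at most 3; the determinant would only give the bound 6.\<close>

lemma card_eigenvalues_le_3:
  fixes A B :: "'k::field_char_0 ^ 6 ^ 6"
  assumes "skew_symmetric A" "skew_symmetric B" "pfaffian A \<noteq> 0"
  shows "finite (eigenvalues A B)" "card (eigenvalues A B) \<le> 3"
proof -
  let ?g = "\<lambda>t. pfaffian (pencil A B t 1)"
  have "\<exists>t. ?g t \<noteq> 0"
  proof (rule ccontr)
    assume "\<nexists>t. ?g t \<noteq> 0"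
    then have 0: "?g t = 0" for t by blast
    \<comment> \<open>Homogeneity carries the vanishing over to the other affine chart for nonzero
      \<open>s\<close>. Cancelling \<open>s\<close> reaches \<open>s = 0\<close>, that is,
      \<open>A\<close> itself.\<close>
    have "s * pfaffian (pencil A B 1 s) = 0" for s
      using pfaffian_scale[of A B s "1 / s" 1] 0[of "1 / s"] by (cases "s = 0") auto
    moreover have "polyfun (\<lambda>s. pfaffian (pencil A B 1 s))"
      unfolding pfaffian_def pf4_def by simp (intro polyfun_intros)
    ultimately have "pfaffian (pencil A B 1 0) = 0" using polyfun_eq_0_if_mult_id_eq_0 by blast
    moreover have "pencil A B 1 0 = A" by (simp add: vec_eq_iff)
    ultimately show False using assms(3) by simp
  qed
  then obtain t where "?g t \<noteq> 0" by blast
  note zeros = card_zeros_polyfun_le[OF polyfun_le_pfaffian_pencil this]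
  have sub: "eigenvalues A B \<subseteq> uminus ` {t. ?g t = 0}"
  proof
    fix \<mu> assume "\<mu> \<in> eigenvalues A B"
    then have "?g (- \<mu>) = 0"
      using pfaffian_nz_inj[OF skew_pencil[OF assms(1,2)]]
      unfolding eigenvalues_def eigenspace_eq_kernel by blast
    then show "\<mu> \<in> uminus ` {t. ?g t = 0}" by (intro image_eqI[of _ _ "- \<mu>"]) auto
  qed
  then show "finite (eigenvalues A B)" using zeros(1) by (metis finite_imageI finite_subset)
  show "card (eigenvalues A B) \<le> 3"
    using card_mono[OF finite_imageI[OF zeros(1)] sub] card_image_le[OF zeros(1), of uminus] zeros(2) by simp
qed

text \<open>Since \<open>A\<close> is injective, a member of the pencil that kills a nonzero vector
  has \<open>l2\<close> nonzero; the eigenvalue is \<open>- l1 / l2\<close>.\<close>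

lemma degeneracy_locus_eq_eigenspaces:
  assumes "\<And>x. A *v x = 0 \<Longrightarrow> x = 0"
  shows "degeneracy_locus A B = (\<Union>\<mu>\<in>eigenvalues A B. proj_points (eigenspace A B \<mu>))"
proof -
  have "(\<exists>l1 l2. (l1, l2) \<noteq> (0, 0) \<and> pencil A B l1 l2 *v x = 0) \<longleftrightarrow> (\<exists>\<mu>. x \<in> eigenspace A B \<mu>)"
    if "x \<noteq> 0" for x
  proof
    assume "\<exists>l1 l2. (l1, l2) \<noteq> (0, 0) \<and> pencil A B l1 l2 *v x = 0"
    then obtain l1 l2 where l: "(l1, l2) \<noteq> (0, 0)" "l1 *s (A *v x) + l2 *s (B *v x) = 0"
      by (auto simp: pencil_mult_vec)
    then have "l2 \<noteq> 0" using assms that by auto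
    have "B *v x = (- l1 / l2) *s (A *v x)"
    proof (rule vec.scale_left_imp_eq[OF \<open>l2 \<noteq> 0\<close>])
      show "l2 *s (B *v x) = l2 *s ((- l1 / l2) *s (A *v x))"
        using l(2) \<open>l2 \<noteq> 0\<close> by (simp add: add_eq_0_iff)
    qed
    then show "\<exists>\<mu>. x \<in> eigenspace A B \<mu>" unfolding eigenspace_def by blast
  next
    assume "\<exists>\<mu>. x \<in> eigenspace A B \<mu>"
    then obtain \<mu> where "pencil A B (- \<mu>) 1 *v x = 0" unfolding eigenspace_eq_kernel by blast
    then show "\<exists>l1 l2. (l1, l2) \<noteq> (0, 0) \<and> pencil A B l1 l2 *v x = 0"
      by (intro exI[of _ "- \<mu>"] exI[of _ 1]) simp
  qed
  then have "(x \<noteq> 0 \<and> (\<exists>l1 l2. (l1, l2) \<noteq> (0, 0) \<and> pencil A B l1 l2 *v x = 0)) =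
      (x \<noteq> 0 \<and> (\<exists>\<mu>. x \<in> eigenspace A B \<mu>))" for x
    by (cases "x = 0") (simp_all only: simp_thms not_True_eq_False not_False_eq_True)
  then have "degeneracy_locus A B = {vec.span {x} | x. x \<noteq> 0 \<and> (\<exists>\<mu>. x \<in> eigenspace A B \<mu>)}"
    unfolding degeneracy_locus_eq by (simp only:)
  also have "\<dots> = (\<Union>\<mu>\<in>eigenvalues A B. proj_points (eigenspace A B \<mu>))"
    unfolding proj_points_eq[OF subspace_eigenspace] eigenvalues_def by auto
  finally show ?thesis .
qed

text \<open>The form is a product of coordinates of \<open>B *v z - \<nu> *s (A *v z)\<close> over
  \<open>\<nu>\<close> in \<open>F\<close>. At \<open>x\<close> this vector is a nonzero multiple of
  \<open>A *v x\<close>, so a coordinate nonzero at \<open>x\<close> can be chosen.\<close>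

lemma form_vanishing_on_eigenspaces:
  assumes "finite F" "\<mu> \<notin> F" "x \<in> eigenspace A B \<mu>" "A *v x \<noteq> 0"
  shows "\<exists>d f. form d f \<and> f x \<noteq> 0 \<and> (\<forall>\<nu>\<in>F. \<forall>z\<in>eigenspace A B \<nu>. f z = 0)"
  using assms(1,2)
proof (induction F)
  case empty
  show ?case using form_coord_power[of 0 undefined] by (intro exI conjI) auto
next
  case (insert \<nu> F)
  then obtain d f where f: "form d f" "f x \<noteq> 0" "\<forall>\<nu>\<in>F. \<forall>z\<in>eigenspace A B \<nu>. f z = 0" by auto
  let ?M = "pencil A B (- \<nu>) 1"
  have "?M *v x = (\<mu> - \<nu>) *s (A *v x)"
    using assms(3) by (simp add: pencil_mult_vec eigenspace_def vec.scale_left_diff_distrib)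
  then have "?M *v x \<noteq> 0" using insert.prems assms(4) by auto
  then obtain i where i: "(?M *v x) $ i \<noteq> 0" by (auto simp: vec_eq_iff)
  show ?case
  proof (intro exI conjI)
    show "form (d + 1) (\<lambda>z. f z * (?M *v z) $ i)" by (intro form_mult f form_matrix_vector)
  qed (use f i in \<open>auto simp: eigenspace_eq_kernel\<close>)
qed

text \<open>
  A vector \<open>y\<close> as below is a tangent vector of the degeneracy scheme at \<open>x\<close>: on the line \<open>x + t y\<close> the
  minors vanish to second order. On the other hand some form vanishing on the locus vanishes only to
  first order there.
\<close>

lemma reduced_imp_semisimple:
  fixes A B :: "'k::field_char_0 ^ 'n ^ 'n"
  assumes red: "degeneracy_scheme_reduced A1 A2" and locus: "degeneracy_locus A1 A2 = degeneracy_locus A B"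
    and minors: "\<And>i j z. minor2 A1 A2 i j z = \<delta> * minor2 A B i j z"
    and inj: "\<And>x. A *v x = 0 \<Longrightarrow> x = 0" and fin: "finite (eigenvalues A B)"
    and x: "x \<in> eigenspace A B \<mu>" and y: "B *v y = \<mu> *s (A *v y) + A *v x"
  shows "x = 0"
proof (rule ccontr)
  assume "x \<noteq> 0"
  then have Ax: "A *v x \<noteq> 0" using inj by blast
  obtain d f where f: "form d f" "f x \<noteq> 0"
    "\<And>\<nu> z. \<nu> \<in> eigenvalues A B - {\<mu>} \<Longrightarrow> z \<in> eigenspace A B \<nu> \<Longrightarrow> f z = 0"
    using form_vanishing_on_eigenspaces[of "eigenvalues A B - {\<mu>}" \<mu> x A B] fin x Ax by auto
  let ?M = "pencil A B (- \<mu>) 1"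
  obtain k where k: "(A *v x) $ k \<noteq> 0" using Ax by (auto simp: vec_eq_iff)
  obtain l where l: "x $ l \<noteq> 0" using \<open>x \<noteq> 0\<close> by (auto simp: vec_eq_iff)
  \<comment> \<open>The factor \<open>f\<close> vanishes on the other eigenspaces and the linear
    factor on that of \<open>\<mu>\<close>. Along \<open>x + t y\<close> the linear factor is
    \<open>t\<close> times a nonzero constant.\<close>
  let ?f = "\<lambda>z. f z * (?M *v z) $ k"
  have form: "form (d + 1) ?f" by (intro form_mult f form_matrix_vector)
  have "vanishes_on ?f {vec.span {z}}" if "\<nu> \<in> eigenvalues A B" "z \<in> eigenspace A B \<nu>" for \<nu> z
    unfolding vanishes_on_span_iff[OF form]
    using f(3)[of \<nu> z] that by (cases "\<nu> = \<mu>") (auto simp: eigenspace_eq_kernel)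
  moreover have locus_eq: "degeneracy_locus A B = (\<Union>\<mu>\<in>eigenvalues A B. proj_points (eigenspace A B \<mu>))"
    using inj by (rule degeneracy_locus_eq_eigenspaces)
  ultimately have vanishes: "vanishes_on ?f (degeneracy_locus A1 A2)"
    unfolding locus locus_eq proj_points_eq[OF subspace_eigenspace]
    by (subst vanishes_on_def) (auto simp: vanishes_on_def[of ?f "{_}"])
  from red[unfolded degeneracy_scheme_reduced_def, THEN spec, THEN spec, THEN mp, OF conjI[OF form vanishes]]
  obtain N where N: "\<forall>h. form N h \<longrightarrow> (\<exists>e g. (\<forall>i j. form e (g i j)) \<and>
       (\<forall>x. ?f x * h x = (\<Sum>i\<in>UNIV. \<Sum>j\<in>UNIV. g i j x * minor2 A1 A2 i j x)))"
    by (elim exE)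
  \<comment> \<open>The multiplier is a power of a coordinate that is nonzero at \<open>x\<close>,
    so it does not raise the order of vanishing there.\<close>
  from N[THEN spec, THEN mp, OF form_coord_power[of N l]]
  obtain e g where eg: "(\<forall>i j. form e (g i j)) \<and>
       (\<forall>x. ?f x * (x $ l) ^ N = (\<Sum>i\<in>UNIV. \<Sum>j\<in>UNIV. g i j x * minor2 A1 A2 i j x))"
    by (elim exE)
  have g: "form e (g i j)"
    "?f x * (x $ l) ^ N = (\<Sum>i\<in>UNIV. \<Sum>j\<in>UNIV. g i j x * minor2 A1 A2 i j x)" for i j x
    using eg by simp_all
  let ?c = "\<lambda>t. x + t *s y"
  have Bc: "B *v ?c t = \<mu> *s (A *v ?c t) + t *s (A *v x)" for t
    using x y by (simp add: eigenspace_def vec.add vec.scale vec.scale_right_distrib algebra_simps)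
  have Mc: "(?M *v ?c t) $ k = t * (A *v x) $ k" for t
    unfolding pencil_mult_vec Bc by simp
  let ?m = "\<lambda>i j. (A *v y) $ i * (A *v x) $ j - (A *v y) $ j * (A *v x) $ i"
  have minor: "minor2 A1 A2 i j (?c t) = t * t * (\<delta> * ?m i j)" for i j t
  proof -
    have "minor2 A B i j (?c t) = t * t * ?m i j"
      unfolding minor2_def Bc by (simp add: vec.add vec.scale algebra_simps)
    then show ?thesis by (simp add: minors)
  qed
  have pc: "polyfun (\<lambda>t. ?c t $ i)" for i by simp (intro polyfun_intros)
  \<comment> \<open>This is the ideal membership restricted to the line and divided by
    \<open>t\<close>. At \<open>t = 0\<close> only a product of nonzero factors remains.\<close>
  have "f (?c t) * (A *v x) $ k * (?c t $ l) ^ N - t * (\<Sum>i\<in>UNIV. \<Sum>j\<in>UNIV. g i j (?c t) * (\<delta> * ?m i j)) = 0"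
    (is "?q t = 0") if "t = 0" for t
  proof -
    have "polyfun ?q" by (intro polyfun_intros polyfun_form[OF f(1)] polyfun_form[OF g(1)] pc)
    moreover have "t * ?q t = 0" for t
    proof -
      have "t * ?q t = ?f (?c t) * (?c t $ l) ^ N
          - (\<Sum>i\<in>UNIV. \<Sum>j\<in>UNIV. g i j (?c t) * minor2 A1 A2 i j (?c t))"
        unfolding minor Mc by (simp add: sum_distrib_left algebra_simps)
      then show ?thesis using g(2)[of "?c t"] by simp
    qed
    ultimately show ?thesis by (rule polyfun_eq_0_if_mult_id_eq_0)
  qed
  from this[OF refl] show False using f(2) k l by simp
qed

section \<open>Eigenvectors in invariant subspaces\<close>

definition poly_app :: "'k::field ^ 'n ^ 'n \<Rightarrow> 'k poly \<Rightarrow> 'k ^ 'n \<Rightarrow> 'k ^ 'n" where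
  "poly_app N p v = (\<Sum>i\<le>degree p. coeff p i *s (((*v) N) ^^ i) v)"

lemma poly_app_eq:
  assumes "degree p \<le> n"
  shows "poly_app N p v = (\<Sum>i\<le>n. coeff p i *s (((*v) N) ^^ i) v)"
  unfolding poly_app_def using assms
  by (intro sum.mono_neutral_left) (auto simp: coeff_eq_0)

lemma poly_app_add: "poly_app N (p + q) v = poly_app N p v + poly_app N q v"
proof -
  let ?n = "max (degree p) (degree q)"
  have "degree (p + q) \<le> ?n" by (rule degree_add_le) auto
  then show ?thesis
    by (simp add: poly_app_eq[of _ ?n] vec.scale_left_distrib sum.distrib)
qed

lemma poly_app_smult: "poly_app N (smult a p) v = a *s poly_app N p v"
  by (simp add: poly_app_eq[of _ "degree p"] vec.scale_sum_right degree_smult_le)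

lemma poly_app_pCons_0: "poly_app N (pCons 0 p) v = N *v poly_app N p v"
proof -
  have "poly_app N (pCons 0 p) v = (\<Sum>i\<le>Suc (degree p). coeff (pCons 0 p) i *s (((*v) N) ^^ i) v)"
    by (rule poly_app_eq) (rule degree_pCons_le)
  also have "\<dots> = (\<Sum>i\<le>degree p. coeff p i *s (N *v (((*v) N) ^^ i) v))"
    by (subst sum.atMost_Suc_shift) simp
  also have "\<dots> = N *v poly_app N p v"
    by (simp add: poly_app_def vec.sum vec.scale)
  finally show ?thesis .
qed

lemma poly_app_in_subspace:
  assumes "vec.subspace U" "\<And>x. x \<in> U \<Longrightarrow> N *v x \<in> U" "v \<in> U"
  shows "poly_app N p v \<in> U"
proof -
  have "(((*v) N) ^^ i) v \<in> U" for i by (induction i) (use assms in auto)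
  then show ?thesis unfolding poly_app_def
    using assms(1) by (intro vec.subspace_sum vec.subspace_scale) auto
qed

text \<open>The first \<open>CARD('n) + 1\<close> iterates of \<open>v\<close> satisfy a linear
  relation. Dependence is a property of sets, so a repetition among the iterates is a separate
  case.\<close>

lemma annihilating_poly:
  fixes N :: "'k::field ^ 'n ^ 'n"
  shows "\<exists>p. p \<noteq> 0 \<and> poly_app N p v = 0"
proof -
  let ?n = "CARD('n)" and ?f = "\<lambda>i. (((*v) N) ^^ i) v"
  have ex: "\<exists>p. p \<noteq> 0 \<and> poly_app N p v = 0"
    if c: "(\<Sum>i\<le>?n. c i *s ?f i) = 0" "c j \<noteq> 0" "j \<le> ?n" for c j
  proof -
    let ?p = "\<Sum>i\<le>?n. monom (c i) i"
    have coeff: "coeff ?p i = (if i \<le> ?n then c i else 0)" for i by (simp add: coeff_sum)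
    have "degree ?p \<le> ?n" by (rule degree_le) (simp add: coeff)
    then have "poly_app N ?p v = 0" using c(1) by (simp add: poly_app_eq coeff)
    moreover have "?p \<noteq> 0" using coeff[of j] c by auto
    ultimately show ?thesis by blast
  qed
  show ?thesis
  proof (cases "inj_on ?f {..?n}")
    case True
    then have "card (?f ` {..?n}) = Suc ?n" by (simp add: card_image)
    then have "vec.dependent (?f ` {..?n})"
      using vec.independent_bound_general[of "?f ` {..?n}"] dim_subset_UNIV_cart_gen[of "?f ` {..?n}"] by auto
    then obtain u x where u: "(\<Sum>x\<in>?f ` {..?n}. u x *s x) = 0" "x \<in> ?f ` {..?n}" "u x \<noteq> 0"
      using vec.dependent_finite[of "?f ` {..?n}"] by auto
    then obtain j where "j \<le> ?n" "u (?f j) \<noteq> 0" by auto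
    moreover have "(\<Sum>i\<le>?n. u (?f i) *s ?f i) = 0"
      using u(1) by (simp add: sum.reindex[OF True])
    ultimately show ?thesis using ex[of "\<lambda>i. u (?f i)" j] by blast
  next
    case False
    then obtain i j where ij: "i \<le> ?n" "j \<le> ?n" "i \<noteq> j" "?f i = ?f j" by (auto simp: inj_on_def)
    let ?c = "\<lambda>k. if k = i then 1 else if k = j then -1 else 0"
    have "(\<Sum>k\<le>?n. ?c k *s ?f k) = (\<Sum>k\<in>{i, j}. ?c k *s ?f k)"
      using ij by (intro sum.mono_neutral_right) auto
    also have "\<dots> = 0" using ij by simp
    finally show ?thesis using ex[of ?c i] ij(1) by simp
  qed
qed

text \<open>A linear factor with root \<open>\<mu>\<close> is split off an annihilating polynomial
  of \<open>v\<close> of minimal degree. By minimality the cofactor does not annihilate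
  \<open>v\<close>, and it maps \<open>v\<close> to an eigenvector.\<close>

lemma eigenvector_in_invariant_subspace:
  fixes N :: "'k::alg_closed_field ^ 'n ^ 'n"
  assumes U: "vec.subspace U" "\<And>x. x \<in> U \<Longrightarrow> N *v x \<in> U" and v: "v \<in> U" "v \<noteq> 0"
  obtains x \<mu> where "x \<in> U" "x \<noteq> 0" "N *v x = \<mu> *s x"
proof -
  define p where "p = arg_min degree (\<lambda>p. p \<noteq> 0 \<and> poly_app N p v = 0)"
  obtain p0 where "p0 \<noteq> 0 \<and> poly_app N p0 v = 0" using annihilating_poly by blast
  then have "p \<noteq> 0 \<and> poly_app N p v = 0" unfolding p_def by (rule arg_min_natI)
  then have p: "p \<noteq> 0" "poly_app N p v = 0" by auto
  have min: "degree p \<le> degree q" if "q \<noteq> 0" "poly_app N q v = 0" for q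
    unfolding p_def by (rule arg_min_nat_le) (use that in blast)
  have "degree p \<noteq> 0"
  proof
    assume "degree p = 0"
    then obtain a where "p = [:a:]" by (rule degree_eq_zeroE)
    then show False using p v(2) by (simp add: poly_app_def)
  qed
  then obtain \<mu> where "poly p \<mu> = 0" using alg_closed_imp_poly_has_root by blast
  then obtain q where q: "p = [:-\<mu>, 1:] * q" by (metis poly_eq_0_iff_dvd dvdE)
  then have "q \<noteq> 0" using p(1) by auto
  then have "degree p = Suc (degree q)" unfolding q by (subst degree_mult_eq) auto
  then have "degree q < degree p" by simp
  then have "poly_app N q v \<noteq> 0" using min \<open>q \<noteq> 0\<close> leD by blast
  moreover have "N *v poly_app N q v = \<mu> *s poly_app N q v"
  proof -
    have "p = smult (- \<mu>) q + pCons 0 q" using q by simp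
    then have "- \<mu> *s poly_app N q v + N *v poly_app N q v = 0"
      using p(2) by (simp only: poly_app_add poly_app_smult poly_app_pCons_0)
    then show ?thesis by (simp add: vec.scale_minus_left)
  qed
  ultimately show ?thesis using that poly_app_in_subspace[OF U v(1)] by blast
qed

section \<open>Orthogonality for the alternating forms of the pencil\<close>

lemma dotp_simps:
  "dotp (x + y) z = dotp x z + dotp y z" "dotp z (x + y) = dotp z x + dotp z y"
  "dotp (c *s x) z = c * dotp x z" "dotp z (c *s x) = c * dotp z x"
  "dotp 0 z = 0" "dotp z 0 = 0"
  by (simp_all add: dotp_def sum.distrib sum_distrib_left algebra_simps)

lemma dotp_eq_0_imp: "(\<And>x. dotp x y = 0) \<Longrightarrow> y = 0"
proof -
  assume "\<And>x. dotp x y = 0"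
  then have "dotp (axis i 1) y = 0" for i by blast
  then show ?thesis by (simp add: dotp_def axis_def vec_eq_iff if_distrib[of "\<lambda>a. a * _"] cong: if_cong)
qed

lemma dotp_commute: "dotp x y = dotp y x"
  by (simp add: dotp_def mult.commute)

lemma dotp_skew:
  assumes "skew_symmetric A"
  shows "dotp x (A *v y) = - dotp y (A *v x)"
proof -
  have "dotp x (A *v y) = (\<Sum>i\<in>UNIV. \<Sum>j\<in>UNIV. x $ i * (A $ i $ j * y $ j))"
    by (simp add: dotp_def matrix_vector_mult_def sum_distrib_left)
  also have "\<dots> = (\<Sum>j\<in>UNIV. \<Sum>i\<in>UNIV. x $ i * (A $ i $ j * y $ j))" by (rule sum.swap)
  also have "\<dots> = (\<Sum>j\<in>UNIV. \<Sum>i\<in>UNIV. - (y $ j * (A $ j $ i * x $ i)))"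
  proof (intro sum.cong refl)
    show "x $ i * (A $ i $ j * y $ j) = - (y $ j * (A $ j $ i * x $ i))" for i j
      using skew_nth[OF assms, of i j] by simp
  qed
  also have "\<dots> = - dotp y (A *v x)"
    by (simp add: dotp_def matrix_vector_mult_def sum_distrib_left sum_negf)
  finally show ?thesis .
qed

lemma dotp_alternating:
  fixes A :: "'k::field_char_0 ^ 'n ^ 'n"
  assumes "skew_symmetric A"
  shows "dotp x (A *v x) = 0"
proof -
  have "2 * dotp x (A *v x) = 0" using dotp_skew[OF assms, of x x] unfolding mult_2 by simp
  then show ?thesis by simp
qed

lemma dotp_eigenspaces:
  assumes "skew_symmetric A" "skew_symmetric B" "x \<in> eigenspace A B \<mu>" "y \<in> eigenspace A B \<nu>" "\<mu> \<noteq> \<nu>"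
  shows "dotp x (A *v y) = 0"
proof -
  have "\<nu> * dotp x (A *v y) = dotp x (B *v y)" using assms(4) by (simp add: eigenspace_def dotp_simps)
  also have "\<dots> = - dotp y (B *v x)" by (rule dotp_skew[OF assms(2)])
  also have "\<dots> = - \<mu> * dotp y (A *v x)" using assms(3) by (simp add: eigenspace_def dotp_simps)
  also have "\<dots> = \<mu> * dotp x (A *v y)" using dotp_skew[OF assms(1), of x y] by simp
  finally show ?thesis using assms(5) by simp
qed

text \<open>Otherwise the orthogonal complement \<open>U\<close> of all eigenspaces for the form
  \<open>A\<close> is nonzero and invariant under \<open>N\<close>, so it contains an eigenvector
  \<open>x\<close>. As \<open>x\<close> is orthogonal to its own eigenspace, \<open>A *v x\<close>
  lies in the image of \<open>B - \<mu> A\<close>, against \<open>semisimple\<close>.\<close>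

lemma span_eigenspaces:
  fixes A B :: "'k::{alg_closed_field, field_char_0} ^ 'n ^ 'n"
  assumes skew: "skew_symmetric A" "skew_symmetric B" and inj: "\<And>x. A *v x = 0 \<Longrightarrow> x = 0"
    and semisimple: "\<And>\<mu> x y. x \<in> eigenspace A B \<mu> \<Longrightarrow> B *v y = \<mu> *s (A *v y) + A *v x \<Longrightarrow> x = 0"
  shows "vec.span (\<Union>\<mu>. eigenspace A B \<mu>) = UNIV" (is "?E = _")
proof (rule ccontr)
  assume "?E \<noteq> UNIV"
  then obtain x0 where "x0 \<notin> ?E" by blast
  then obtain w where w: "\<And>u. u \<in> ?E \<Longrightarrow> dotp w u = 0" "dotp w x0 \<noteq> 0"
    using separating_vector[OF vec.subspace_span] by metis
  have "\<exists>A'. A' ** A = mat 1" unfolding matrix_left_invertible_ker using inj by blast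
  then obtain A' where A': "A ** A' = mat 1" using matrix_left_right_inverse by blast
  define N where "N = A' ** B"
  have N: "A *v (N *v z) = B *v z" for z
    by (simp add: N_def matrix_vector_mul_assoc matrix_mul_assoc A')
  have A'w: "A *v (A' *v w) = w" by (simp add: A' matrix_vector_mul_assoc)
  define U where "U = {z. \<forall>\<mu>. \<forall>e\<in>eigenspace A B \<mu>. dotp e (A *v z) = 0}"
  have "vec.subspace U" by (auto simp: U_def vec.subspace_def vec.add vec.scale dotp_simps)
  moreover have "N *v z \<in> U" if "z \<in> U" for z
  proof -
    have "dotp e (B *v z) = 0" if e: "e \<in> eigenspace A B \<mu>" for e \<mu>
    proof -
      have "dotp e (B *v z) = - \<mu> * dotp z (A *v e)"
        using e by (simp add: dotp_skew[OF skew(2), of e] eigenspace_def dotp_simps)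
      also have "\<dots> = \<mu> * dotp e (A *v z)" by (simp add: dotp_skew[OF skew(1), of z])
      finally show ?thesis using \<open>z \<in> U\<close> e by (auto simp: U_def)
    qed
    then show ?thesis by (auto simp: U_def N)
  qed
  moreover have "dotp e w = 0" if e: "e \<in> eigenspace A B \<mu>" for e \<mu>
  proof -
    have "e \<in> ?E" by (rule vec.span_base) (use e in blast)
    then have "dotp w e = 0" by (rule w(1))
    then show ?thesis by (simp only: dotp_commute[of e w])
  qed
  then have "A' *v w \<in> U" by (simp add: U_def A'w)
  moreover have "A' *v w \<noteq> 0" using w(2) A'w by (auto simp: dotp_simps)
  ultimately obtain x \<mu> where x: "x \<in> U" "x \<noteq> 0" "N *v x = \<mu> *s x"
    by (rule eigenvector_in_invariant_subspace)
  have "B *v x = \<mu> *s (A *v x)" using N[of x] by (simp add: x(3) vec.scale)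
  then have eig: "x \<in> eigenspace A B \<mu>" by (simp add: eigenspace_def)
  let ?C = "pencil A B (- \<mu>) 1"
  \<comment> \<open>The image of a skew-symmetric matrix is the annihilator of its kernel, and the
    kernel of \<open>?C\<close> is the eigenspace of \<open>\<mu>\<close>.\<close>
  have "A *v x \<in> range ((*v) ?C)"
  proof (rule ccontr)
    assume "A *v x \<notin> range ((*v) ?C)"
    moreover have "vec.subspace (range ((*v) ?C))"
      by (rule vec.subspace_image) (rule vec.subspace_UNIV)
    ultimately obtain u where u: "\<And>y. y \<in> range ((*v) ?C) \<Longrightarrow> dotp u y = 0" "dotp u (A *v x) \<noteq> 0"
      using separating_vector by metis
    have "dotp y (?C *v u) = 0" for y
    proof -
      have "dotp y (?C *v u) = - dotp u (?C *v y)" by (rule dotp_skew[OF skew_pencil[OF skew]])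
      then show ?thesis by (simp add: u(1))
    qed
    then have "?C *v u = 0" by (rule dotp_eq_0_imp)
    then have "u \<in> eigenspace A B \<mu>" by (simp add: eigenspace_eq_kernel)
    then show False using u(2) x(1) by (auto simp: U_def)
  qed
  then obtain y where "A *v x = ?C *v y" by blast
  then have "B *v y = \<mu> *s (A *v y) + A *v x" by (simp add: pencil_mult_vec)
  then show False using semisimple[OF eig] x(2) by blast
qed

text \<open>An eigenvector spanning its eigenspace is orthogonal to itself, because \<open>A\<close>
  is alternating, and to all other eigenspaces. It would lie in the radical of \<open>A\<close>,
  which is zero.\<close>

lemma dim_eigenspace_ge_2:
  fixes A B :: "'k::field_char_0 ^ 'n ^ 'n"
  assumes skew: "skew_symmetric A" "skew_symmetric B" and inj: "\<And>x. A *v x = 0 \<Longrightarrow> x = 0"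
    and span: "vec.span (\<Union>\<mu>. eigenspace A B \<mu>) = UNIV" and \<mu>: "\<mu> \<in> eigenvalues A B"
  shows "vec.dim (eigenspace A B \<mu>) \<ge> 2"
proof (rule ccontr)
  assume "\<not> ?thesis"
  then have dim: "vec.dim (eigenspace A B \<mu>) \<le> 1" by simp
  obtain x where x: "x \<noteq> 0" "x \<in> eigenspace A B \<mu>" using \<mu> by (auto simp: eigenvalues_def)
  have "vec.span {x} = eigenspace A B \<mu>"
    using x dim subspace_eigenspace[of A B \<mu>] by (intro vec.subspace_dim_equal vec.span_minimal) auto
  then have multiple: "\<exists>c. e = c *s x" if "e \<in> eigenspace A B \<mu>" for e
    using that unfolding vec.span_singleton by blast
  have "dotp e (A *v x) = 0" if e: "e \<in> eigenspace A B \<nu>" for e \<nu>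
  proof (cases "\<nu> = \<mu>")
    case True
    then obtain c where "e = c *s x" using multiple e by blast
    then show ?thesis by (simp add: dotp_simps dotp_alternating[OF skew(1)])
  next
    case False
    then show ?thesis by (intro dotp_eigenspaces[OF skew e x(2)])
  qed
  then have "(\<Union>\<mu>. eigenspace A B \<mu>) \<subseteq> {v. dotp v (A *v x) = 0}" by blast
  moreover have "vec.subspace {v. dotp v (A *v x) = 0}" by (auto simp: vec.subspace_def dotp_simps)
  ultimately have "vec.span (\<Union>\<mu>. eigenspace A B \<mu>) \<subseteq> {v. dotp v (A *v x) = 0}" by (rule vec.span_minimal)
  then have "A *v x = 0" unfolding span by (intro dotp_eq_0_imp) auto
  then show False using inj x(1) by blast
qed

lemma dim_Un_le: "vec.dim (S \<union> T) \<le> vec.dim S + vec.dim (T :: ('k::field ^ 'n) set)"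
proof -
  obtain B C where B: "B \<subseteq> S" "vec.independent B" "S \<subseteq> vec.span B" "card B = vec.dim S"
    and C: "C \<subseteq> T" "vec.independent C" "T \<subseteq> vec.span C" "card C = vec.dim T"
    using vec.basis_exists by metis
  have "S \<union> T \<subseteq> vec.span (B \<union> C)"
    using B(3) C(3) vec.span_mono[of B "B \<union> C"] vec.span_mono[of C "B \<union> C"] by blast
  moreover have "finite (B \<union> C)" using B(2) C(2) vec.finiteI_independent by blast
  ultimately have "vec.dim (S \<union> T) \<le> card (B \<union> C)" by (rule vec.dim_le_card)
  also have "\<dots> \<le> card B + card C" by (rule card_Un_le)
  finally show ?thesis using B(4) C(4) by simp
qed

lemma regular_pencil_three_eigenspaces:
  fixes A B :: "'k::{alg_closed_field, field_char_0} ^ 6 ^ 6"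
  assumes skew: "skew_symmetric A" "skew_symmetric B" and pf: "pfaffian A \<noteq> 0"
    and dim_le: "\<And>\<mu>. vec.dim (eigenspace A B \<mu>) \<le> 2"
    and span: "vec.span (\<Union>\<mu>. eigenspace A B \<mu>) = UNIV"
  obtains \<mu>1 \<mu>2 \<mu>3 where "\<mu>1 \<noteq> \<mu>2" "\<mu>1 \<noteq> \<mu>3" "\<mu>2 \<noteq> \<mu>3" "eigenvalues A B = {\<mu>1, \<mu>2, \<mu>3}"
proof -
  \<comment> \<open>Two eigenspaces span at most four of the six dimensions. As \<open>a\<close> and
    \<open>b\<close> are arbitrary, this one fact yields all three eigenvalues; \<open>{0}\<close>
    accounts for values that are not eigenvalues.\<close>
  have more: "\<exists>\<mu>\<in>eigenvalues A B. \<mu> \<noteq> a \<and> \<mu> \<noteq> b" for a b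
  proof (rule ccontr)
    assume "\<not> ?thesis"
    then have "x \<in> {0} \<union> (eigenspace A B a \<union> eigenspace A B b)" if "x \<in> eigenspace A B \<mu>" for \<mu> x
      using that by (auto simp: eigenvalues_def)
    then have "(\<Union>\<mu>. eigenspace A B \<mu>) \<subseteq> {0} \<union> (eigenspace A B a \<union> eigenspace A B b)" by blast
    then have "vec.dim (\<Union>\<mu>. eigenspace A B \<mu>) \<le> vec.dim ({0} \<union> (eigenspace A B a \<union> eigenspace A B b))"
      by (rule vec.dim_subset)
    also have "\<dots> \<le> 4"
      using dim_Un_le[of "{0}" "eigenspace A B a \<union> eigenspace A B b"]
        dim_Un_le[of "eigenspace A B a" "eigenspace A B b"] dim_le[of a] dim_le[of b] by simp
    finally have "vec.dim (vec.span (\<Union>\<mu>. eigenspace A B \<mu>)) \<le> 4" by simp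
    then show False unfolding span vec_dim_card by simp
  qed
  obtain \<mu>1 where 1: "\<mu>1 \<in> eigenvalues A B" using more by blast
  obtain \<mu>2 where 2: "\<mu>2 \<in> eigenvalues A B" "\<mu>2 \<noteq> \<mu>1" using more by blast
  obtain \<mu>3 where 3: "\<mu>3 \<in> eigenvalues A B" "\<mu>3 \<noteq> \<mu>1" "\<mu>3 \<noteq> \<mu>2" using more by blast
  have "{\<mu>1, \<mu>2, \<mu>3} = eigenvalues A B"
    using card_eigenvalues_le_3[OF skew pf] 1 2 3 by (intro card_seteq) auto
  then show ?thesis using that[of \<mu>1 \<mu>2 \<mu>3] 2 3 by metis
qed

section \<open>Change of basis in the pencil\<close>

lemma pencil_pencil:
  "pencil (pencil A1 A2 a b) (pencil A1 A2 c d) l1 l2 = pencil A1 A2 (l1 * a + l2 * c) (l1 * b + l2 * d)"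
  by (simp add: vec_eq_iff algebra_simps)

lemma degeneracy_locus_pencil:
  assumes "a * d - b * c \<noteq> 0"
  shows "degeneracy_locus (pencil A1 A2 a b) (pencil A1 A2 c d) = degeneracy_locus A1 A2"
proof -
  let ?D = "a * d - b * c"
  have "(\<exists>l1 l2. (l1, l2) \<noteq> (0, 0) \<and> pencil (pencil A1 A2 a b) (pencil A1 A2 c d) l1 l2 *v x = 0) \<longleftrightarrow>
      (\<exists>l1 l2. (l1, l2) \<noteq> (0, 0) \<and> pencil A1 A2 l1 l2 *v x = 0)" for x
  proof
    assume "\<exists>l1 l2. (l1, l2) \<noteq> (0, 0) \<and> pencil (pencil A1 A2 a b) (pencil A1 A2 c d) l1 l2 *v x = 0"
    then obtain l1 l2 where l: "(l1, l2) \<noteq> (0, 0)"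
      "pencil A1 A2 (l1 * a + l2 * c) (l1 * b + l2 * d) *v x = 0"
      unfolding pencil_pencil by blast
    have "(l1 * a + l2 * c, l1 * b + l2 * d) \<noteq> (0, 0)"
    proof
      assume "(l1 * a + l2 * c, l1 * b + l2 * d) = (0, 0)"
      then have 0: "l1 * a + l2 * c = 0" "l1 * b + l2 * d = 0" by auto
      have "l1 * ?D = (l1 * a + l2 * c) * d - (l1 * b + l2 * d) * c"
        "l2 * ?D = (l1 * b + l2 * d) * a - (l1 * a + l2 * c) * b" by (simp_all add: algebra_simps)
      then show False using l(1) assms unfolding 0 by simp
    qed
    then show "\<exists>l1 l2. (l1, l2) \<noteq> (0, 0) \<and> pencil A1 A2 l1 l2 *v x = 0" using l(2) by blast
  next
    assume "\<exists>l1 l2. (l1, l2) \<noteq> (0, 0) \<and> pencil A1 A2 l1 l2 *v x = 0"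
    then obtain l1 l2 where l: "(l1, l2) \<noteq> (0, 0)" "pencil A1 A2 l1 l2 *v x = 0" by blast
    \<comment> \<open>Cramer's rule inverts the change of basis.\<close>
    define m1 m2 where "m1 = (l1 * d - l2 * c) / ?D" and "m2 = (l2 * a - l1 * b) / ?D"
    have m: "m1 * a + m2 * c = l1" "m1 * b + m2 * d = l2"
      unfolding m1_def m2_def using assms
      by (simp_all add: add_divide_distrib[symmetric] divide_eq_eq) (simp_all add: algebra_simps)
    then have "(m1, m2) \<noteq> (0, 0)" using l(1) by auto
    then show "\<exists>l1 l2. (l1, l2) \<noteq> (0, 0) \<and> pencil (pencil A1 A2 a b) (pencil A1 A2 c d) l1 l2 *v x = 0"
      unfolding pencil_pencil using l(2) m by metis
  qed
  then show ?thesis unfolding degeneracy_locus_eq by (simp only:)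
qed

lemma minor2_pencil:
  "minor2 (pencil A1 A2 a b) (pencil A1 A2 c d) i j x = (a * d - b * c) * minor2 A1 A2 i j x"
  by (simp add: minor2_def pencil_mult_vec algebra_simps)

section \<open>The degeneracy locus\<close>

theorem theorem1:
  fixes A1 A2 :: "'k::{alg_closed_field, field_char_0} ^ 6 ^ 6"
  assumes "skew_symmetric A1" and "skew_symmetric A2"
    and "has_dimension (degeneracy_locus A1 A2) 1"
    and "degeneracy_scheme_reduced A1 A2"
  shows "\<exists>L1 L2 L3. proj_line L1 \<and> proj_line L2 \<and> proj_line L3 \<and>
    L1 \<inter> L2 = {} \<and> L1 \<inter> L3 = {} \<and> L2 \<inter> L3 = {} \<and>
    degeneracy_locus A1 A2 = L1 \<union> L2 \<union> L3 \<and>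
    linear_span (L1 \<union> L2 \<union> L3) = proj_space"
proof -
  let ?X = "degeneracy_locus A1 A2"
  have no_chain: "\<not> irreducible_chain ?X 2"
    using assms(3) by (simp add: has_dimension_def numeral_2_eq_2)
  then obtain a b where ab: "pfaffian (pencil A1 A2 a b) \<noteq> 0"
    using irreducible_chain_2_singular_pencil[OF assms(1,2)] by blast
  have "(a, b) \<noteq> (0, 0)"
  proof
    assume "(a, b) = (0, 0)"
    then show False using ab by (simp add: pfaffian_def)
  qed
  \<comment> \<open>One of \<open>(0, 1)\<close> and \<open>(1, 0)\<close> completes
    \<open>(a, b)\<close> to a basis.\<close>
  then have "a * 1 - b * 0 \<noteq> 0 \<or> a * 0 - b * 1 \<noteq> 0" by auto
  then obtain c d where cd: "a * d - b * c \<noteq> 0" by blast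
  define A B where "A = pencil A1 A2 a b" and "B = pencil A1 A2 c d"
  have skew: "skew_symmetric A" "skew_symmetric B"
    unfolding A_def B_def using skew_pencil[OF assms(1,2)] by auto
  have pf: "pfaffian A \<noteq> 0" using ab A_def by simp
  have inj: "x = 0" if "A *v x = 0" for x using pfaffian_nz_inj[OF skew(1) pf that] .
  have X: "?X = degeneracy_locus A B" unfolding A_def B_def degeneracy_locus_pencil[OF cd] ..
  \<comment> \<open>The minors change only by the determinant of the base change, so reducedness for
    \<open>A1\<close>, \<open>A2\<close> can be exploited in terms of \<open>A\<close>,
    \<open>B\<close>.\<close>
  have minors: "minor2 A1 A2 i j z = (1 / (a * d - b * c)) * minor2 A B i j z" for i j z
    unfolding A_def B_def minor2_pencil using cd by simp
  have X_eq: "?X = (\<Union>\<mu>\<in>eigenvalues A B. proj_points (eigenspace A B \<mu>))"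
    unfolding X using inj by (rule degeneracy_locus_eq_eigenspaces)
  have dim_le: "vec.dim (eigenspace A B \<mu>) \<le> 2" for \<mu>
  proof (rule ccontr)
    assume "\<not> ?thesis"
    then have "vec.dim (eigenspace A B \<mu>) \<ge> 3" by simp
    then have "irreducible_chain (degeneracy_locus A B) 2"
      by (rule irreducible_chain_2_kernel[OF subspace_eigenspace, of A B \<mu> "- \<mu>" 1])
        (auto simp: eigenspace_eq_kernel)
    then show False using no_chain X by simp
  qed
  have semisimple: "x = 0" if "x \<in> eigenspace A B \<mu>" "B *v y = \<mu> *s (A *v y) + A *v x" for \<mu> x y
    using reduced_imp_semisimple[OF assms(4) X minors _ card_eigenvalues_le_3(1)[OF skew pf] that] inj by blast
  have span: "vec.span (\<Union>\<mu>. eigenspace A B \<mu>) = UNIV"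
    using span_eigenspaces[OF skew] inj semisimple by blast
  obtain \<mu>1 \<mu>2 \<mu>3 where \<mu>: "\<mu>1 \<noteq> \<mu>2" "\<mu>1 \<noteq> \<mu>3" "\<mu>2 \<noteq> \<mu>3" "eigenvalues A B = {\<mu>1, \<mu>2, \<mu>3}"
    using regular_pencil_three_eigenspaces[OF skew pf dim_le span] by blast
  define L where "L \<mu> = proj_points (eigenspace A B \<mu>)" for \<mu>
  have line: "proj_line (L \<mu>)" if "\<mu> \<in> eigenvalues A B" for \<mu>
  proof -
    have "vec.dim (eigenspace A B \<mu>) \<ge> 2"
      by (rule dim_eigenspace_ge_2[OF skew _ span that]) (rule inj)
    then have "vec.dim (eigenspace A B \<mu>) = 2" using dim_le[of \<mu>] by simp
    then show ?thesis unfolding proj_line_def L_def using subspace_eigenspace by blast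
  qed
  have disj: "L \<mu> \<inter> L \<nu> = {}" if "\<mu> \<noteq> \<nu>" for \<mu> \<nu>
  proof (rule ccontr)
    assume "L \<mu> \<inter> L \<nu> \<noteq> {}"
    then obtain x where x: "x \<noteq> 0" "x \<in> eigenspace A B \<mu>" "vec.span {x} \<in> L \<nu>"
      unfolding L_def proj_points_eq[OF subspace_eigenspace, of A B \<mu>] by blast
    then have "x \<in> eigenspace A B \<nu>"
      unfolding L_def span_in_proj_points_iff[OF subspace_eigenspace x(1)] by simp
    then show False using eigenspaces_disjoint[OF _ x(2) _ that] inj x(1) by blast
  qed
  have X_L: "?X = L \<mu>1 \<union> L \<mu>2 \<union> L \<mu>3" unfolding X_eq \<mu>(4) L_def by auto
  have "eigenspace A B \<mu> \<subseteq> vec.span (\<Union>?X)" for \<mu>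
  proof
    fix x assume x: "x \<in> eigenspace A B \<mu>"
    show "x \<in> vec.span (\<Union>?X)"
    proof (cases "x = 0")
      case True
      then show ?thesis by (simp add: vec.span_zero)
    next
      case False
      then have "vec.span {x} \<in> ?X"
        unfolding X_eq proj_points_eq[OF subspace_eigenspace] eigenvalues_def using x by blast
      moreover have "x \<in> vec.span {x}" by (rule vec.span_base) simp
      ultimately show ?thesis by (intro vec.span_base) blast
    qed
  qed
  then have "vec.span (\<Union>\<mu>. eigenspace A B \<mu>) \<subseteq> vec.span (\<Union>?X)"
    by (intro vec.span_minimal vec.subspace_span) blast
  then have "linear_span ?X = proj_space" unfolding linear_span_def span by (simp add: top.extremum_unique)
  then show ?thesis
    unfolding X_L using line disj \<mu> by (intro exI[of _ "L \<mu>1"] exI[of _ "L \<mu>2"] exI[of _ "L \<mu>3"]) simp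
qed

end
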